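(* Let $n=2^k-1$ with $k\ge 2$ an integer and $\mathcal H=\bigotimes_{j=1}^n\mathbb C^2$. Let $S_1,\dots,S_r\subseteq[n]$ and let $D_1,\dots,D_r$ be subspaces of $\mathcal H$ with $\sum_{i=1}^r\dim D_i^\perp\le n$. Then there exists a nonzero product vector $\ket\psi=\ket{\psi_1}\otimes\cdots\otimes\ket{\psi_n}$ with $\ket\psi^{\Gamma(S_i)}\in D_i$ for all $i=1,\dots,r$.
   Context: For $S\subseteq[n]$, $\ket\psi^{\Gamma(S)}$ is obtained from $\ket\psi=\ket{\psi_1}\otimes\cdots\otimes\ket{\psi_n}$ by replacing $\ket{\psi_j}$ with its complex conjugate for each $j\in S$. $D^\perp$ is the orthogonal complement; $\sum_i\dim D_i^\perp$ is the number of (linear) equations of the system. *)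

theory Defs
  imports "HOL-Analysis.Analysis" "HOL-Library.Function_Algebras"
begin

text \<open>The n-qubit space H = (C^2)^{\<otimes> n}, qubits indexed 0..n-1, realised as complex
functions on bit strings x :: nat \<Rightarrow> bool that vanish outside the 2^n strings
with x j = False for all j \<ge> n.\<close>

type_synonym qvec = "(nat \<Rightarrow> bool) \<Rightarrow> complex"

definition bitstrs :: "nat \<Rightarrow> (nat \<Rightarrow> bool) set" where
  "bitstrs n = {x. \<forall>j\<ge>n. \<not> x j}"

definition qspace :: "nat \<Rightarrow> qvec set" where
  "qspace n = {v. \<forall>x. x \<notin> bitstrs n \<longrightarrow> v x = 0}"

definition qscale :: "complex \<Rightarrow> qvec \<Rightarrow> qvec" where
  "qscale c v = (\<lambda>x. c * v x)"

definition qinner :: "nat \<Rightarrow> qvec \<Rightarrow> qvec \<Rightarrow> complex" where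
  "qinner n u v = (\<Sum>x\<in>bitstrs n. cnj (u x) * v x)"

definition is_qsubspace :: "nat \<Rightarrow> qvec set \<Rightarrow> bool" where
  "is_qsubspace n D \<longleftrightarrow> D \<subseteq> qspace n \<and> 0 \<in> D \<and> (\<forall>u\<in>D. \<forall>v\<in>D. u + v \<in> D)
     \<and> (\<forall>c. \<forall>v\<in>D. qscale c v \<in> D)"

definition orth_comp :: "nat \<Rightarrow> qvec set \<Rightarrow> qvec set" where
  "orth_comp n D = {u \<in> qspace n. \<forall>v\<in>D. qinner n u v = 0}"

definition cdim :: "qvec set \<Rightarrow> nat" where
  "cdim V = vector_space.dim qscale V"

text \<open>The vector |\<psi>\<rangle>^{\<Gamma>(S)} for the product vector |\<psi>\<rangle> = |\<psi>_0\<rangle> \<otimes> ... \<otimes> |\<psi>_{n-1}\<rangle>,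
where \<psi> j :: bool \<Rightarrow> complex gives the two coordinates of the j-th factor;
factors with j \<in> S are complex conjugated.  S = {} gives |\<psi>\<rangle> itself.\<close>
definition prodvec_conj :: "nat \<Rightarrow> nat set \<Rightarrow> (nat \<Rightarrow> bool \<Rightarrow> complex) \<Rightarrow> qvec" where
  "prodvec_conj n S \<psi> = (\<lambda>x. if x \<in> bitstrs n then
      (\<Prod>j<n. if j \<in> S then cnj (\<psi> j (x j)) else \<psi> j (x j)) else 0)"

end

theory Submission
  imports Defs
begin

text \<open>The equations are \<open>n\<close> sections of line bundles of multidegree \<open>(\<epsilon>\<^sub>i\<^sub>1, \<dots>, \<epsilon>\<^sub>i\<^sub>n)\<close>, \<open>\<epsilon>\<^sub>i\<^sub>j = \<plusminus>1\<close>,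
  over \<open>(P\<^sup>1)\<^sup>n\<close>, where \<open>\<epsilon>\<^sub>i\<^sub>j = -1\<close> marks a conjugated factor. Each bundle carries a connection whose
  curvature vanishes wherever the section is not small. Without a common zero, at every point
  one of the curvatures vanishes, so their wedge product is identically zero. By Stokes' theorem
  its integral does not depend on the connections, and the standard connections give
  \<open>(2\<pi>)\<^sup>n\<close> times the permanent of \<open>(\<epsilon>\<^sub>i\<^sub>j)\<close>, which is nonzero for \<open>n = 2^k - 1\<close> by a 2-adic argument.\<close>

section \<open>Calculus with partial derivatives\<close>

text \<open>Conjugated factors make the equations only real algebraic, so complex dimension theory
  yields no common zero. What remains is a signed count of zeros, and the permanent is that
  intersection number. Forms are handled through their coefficients on the cube of dimension 2n that
  covers (P^1)^n by latitudes and longitudes. The cube has a boundary although (P^1)^n has none. Its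
  terms cancel because two connections on one bundle differ by a genuine 1-form, which has no
  longitude component at the poles. Sections are C^3 and connections C^2, which is enough for d d =
  0, so the cut-off can be the cube of \<open>max 0 x\<close>. Being small is measured against the
  sum of all |s_i|^2, so that no positive lower bound has to be drawn from compactness. For n = 2^k
  - 1 the exponent of 2 in n! is n - k, while \<open>2 ^ |T| * (n - |T|)!\<close> is divisible by
  2^(n-k+1) for every nonempty \<open>T\<close>.\<close>

definition pd :: "'i \<Rightarrow> (('i \<Rightarrow> real) \<Rightarrow> real) \<Rightarrow> ('i \<Rightarrow> real) \<Rightarrow> real" where
  "pd a g v = deriv (\<lambda>x. g (v(a := x))) (v a)"

text \<open>Derivatives are taken along coordinate lines only. Joint continuity, in the product
  topology, of all iterated ones up to order \<open>k\<close> is what makes mixed derivatives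
  commute and permits differentiation under the integral. Points are functions on an index type, so
  no dimension is encoded in a type.\<close>

fun Cs :: "nat \<Rightarrow> (('i \<Rightarrow> real) \<Rightarrow> real) \<Rightarrow> bool" where
  "Cs 0 g \<longleftrightarrow> continuous_on UNIV g"
| "Cs (Suc k) g \<longleftrightarrow> continuous_on UNIV g \<and>
     (\<forall>a. (\<forall>v. (\<lambda>x. g (v(a := x))) differentiable at (v a)) \<and> Cs k (pd a g))"

lemma Cs_continuous: "Cs k g \<Longrightarrow> continuous_on UNIV g"
  by (cases k) auto

lemma Cs_SucD: "Cs (Suc k) g \<Longrightarrow> Cs k g"
proof (induction k arbitrary: g)
  case (Suc k)
  then show ?case by (simp only: Cs.simps) blast
qed auto

lemma Cs_pd: "Cs (Suc k) g \<Longrightarrow> Cs k (pd a g)"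
  by simp

lemma Cs_DERIV:
  assumes "Cs (Suc k) g"
  shows "((\<lambda>x. g (v(a := x))) has_real_derivative pd a g (v(a := y))) (at y)"
proof -
  have "\<And>v. (\<lambda>x. g (v(a := x))) differentiable at (v a)"
    using assms by simp
  from this[of "v(a := y)"] have "(\<lambda>x. g (v(a := x))) differentiable at y" by simp
  then have "(\<lambda>x. g (v(a := x))) field_differentiable at y"
    by (auto simp: field_differentiable_def real_differentiable_def)
  then show ?thesis
    by (simp add: pd_def field_differentiable_derivI)
qed

lemma Cs_DERIV': "Cs (Suc k) g \<Longrightarrow> ((\<lambda>x. g (v(a := x))) has_real_derivative pd a g v) (at (v a))"
  using Cs_DERIV[of k g v a "v a"] by simp

lemma pd_eqI: "((\<lambda>x. g (v(a := x))) has_real_derivative d) (at (v a)) \<Longrightarrow> pd a g v = d"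
  unfolding pd_def by (rule DERIV_imp_deriv)

lemma Cs_SucI:
  assumes "continuous_on UNIV g"
    and "\<And>a v. ((\<lambda>x. g (v(a := x))) has_real_derivative g' a v) (at (v a))"
    and "\<And>a. Cs k (g' a)"
  shows "Cs (Suc k) g"
proof -
  have "pd a g = g' a" for a
    using assms(2) by (intro ext pd_eqI)
  then show ?thesis
    using assms(1,3) assms(2)[THEN real_differentiable_def[THEN iffD2, OF exI]]
    unfolding Cs.simps by (intro conjI allI) (simp_all only:)
qed

lemma Cs_const [simp]: "Cs k (\<lambda>v. c)"
proof (induction k arbitrary: c)
  case (Suc k)
  show ?case by (rule Cs_SucI[where g' = "\<lambda>a v. 0"]) (use Suc in auto)
qed auto

lemma pd_const [simp]: "pd a (\<lambda>v. c) v = 0"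
  by (rule pd_eqI) auto

lemma Cs_coord: "Cs k (\<lambda>v. v b)"
proof (cases k)
  case (Suc m)
  show ?thesis unfolding Suc
    by (rule Cs_SucI[where g' = "\<lambda>a v. if a = b then 1 else 0"])
       (auto intro!: derivative_eq_intros)
qed auto

lemma Cs_add: "Cs k f \<Longrightarrow> Cs k g \<Longrightarrow> Cs k (\<lambda>v. f v + g v)"
proof (induction k arbitrary: f g)
  case (Suc k)
  show ?case
  proof (rule Cs_SucI[where g' = "\<lambda>a v. pd a f v + pd a g v"])
    show "continuous_on UNIV (\<lambda>v. f v + g v)"
      using Suc.prems by (intro continuous_intros Cs_continuous)
    show "((\<lambda>x. f (v(a := x)) + g (v(a := x))) has_real_derivative pd a f v + pd a g v) (at (v a))" for a v
      by (intro DERIV_add Cs_DERIV'[OF Suc.prems(1)] Cs_DERIV'[OF Suc.prems(2)])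
    show "Cs k (\<lambda>v. pd a f v + pd a g v)" for a
      using Suc by simp
  qed
qed (auto intro: continuous_intros)

lemma pd_add: "Cs (Suc k) f \<Longrightarrow> Cs (Suc m) g \<Longrightarrow> pd a (\<lambda>v. f v + g v) v = pd a f v + pd a g v"
  by (rule pd_eqI) (intro DERIV_add Cs_DERIV'; assumption)

lemma Cs_mult: "Cs k f \<Longrightarrow> Cs k g \<Longrightarrow> Cs k (\<lambda>v. f v * g v)"
proof (induction k arbitrary: f g)
  case (Suc k)
  note S = Suc.prems[THEN Cs_SucD]
  show ?case
  proof (rule Cs_SucI[where g' = "\<lambda>a v. pd a f v * g v + pd a g v * f v"])
    show "continuous_on UNIV (\<lambda>v. f v * g v)"
      using Suc.prems by (intro continuous_intros Cs_continuous)
    show "((\<lambda>x. f (v(a := x)) * g (v(a := x))) has_real_derivative pd a f v * g v + pd a g v * f v) (at (v a))" for a v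
      by (rule DERIV_cong[OF DERIV_mult[OF Cs_DERIV'[OF Suc.prems(1)] Cs_DERIV'[OF Suc.prems(2)]]]) simp
    show "Cs k (\<lambda>v. pd a f v * g v + pd a g v * f v)" for a
      using Suc S by (intro Cs_add Suc.IH) auto
  qed
qed (auto intro: continuous_intros)

lemma pd_mult: "Cs (Suc k) f \<Longrightarrow> Cs (Suc m) g \<Longrightarrow>
    pd a (\<lambda>v. f v * g v) v = pd a f v * g v + f v * pd a g v"
  by (rule pd_eqI, rule DERIV_cong[OF DERIV_mult[OF Cs_DERIV' Cs_DERIV']], assumption, assumption) simp

lemma Cs_minus: "Cs k f \<Longrightarrow> Cs k (\<lambda>v. - f v)"
  using Cs_mult[OF Cs_const[of k "-1"], of f] by simp

lemma Cs_diff: "Cs k f \<Longrightarrow> Cs k g \<Longrightarrow> Cs k (\<lambda>v. f v - g v)"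
  using Cs_add[OF _ Cs_minus, of k f g] by simp

lemma pd_diff: "Cs (Suc k) f \<Longrightarrow> Cs (Suc m) g \<Longrightarrow> pd a (\<lambda>v. f v - g v) v = pd a f v - pd a g v"
  by (rule pd_eqI) (intro DERIV_diff Cs_DERIV'; assumption)

lemma Cs_sum: "(\<And>i. i \<in> I \<Longrightarrow> Cs k (f i)) \<Longrightarrow> Cs k (\<lambda>v. \<Sum>i\<in>I. f i v)"
  by (induction I rule: infinite_finite_induct) (auto intro: Cs_add)

lemma Cs_prod: "(\<And>i. i \<in> I \<Longrightarrow> Cs k (f i)) \<Longrightarrow> Cs k (\<lambda>v. \<Prod>i\<in>I. f i v)"
  by (induction I rule: infinite_finite_induct) (auto intro: Cs_mult)

lemma pd_prod:
  assumes "finite I" "\<And>i. i \<in> I \<Longrightarrow> Cs (Suc k) (f i)"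
  shows "pd a (\<lambda>v. \<Prod>i\<in>I. f i v) v = (\<Sum>i\<in>I. pd a (f i) v * (\<Prod>j\<in>I - {i}. f j v))"
proof (rule pd_eqI)
  have "((\<lambda>x. \<Prod>i\<in>I. f i (v(a := x))) has_field_derivative
      (\<Sum>i\<in>I. pd a (f i) v * (\<Prod>j\<in>I - {i}. f j (v(a := v a))))) (at (v a))"
    using assms by (intro has_field_derivative_prod Cs_DERIV')
  then show "((\<lambda>x. \<Prod>i\<in>I. f i (v(a := x))) has_field_derivative
      (\<Sum>i\<in>I. pd a (f i) v * (\<Prod>j\<in>I - {i}. f j v))) (at (v a))" by simp
qed

lemma Cs_inverse:
  assumes "Cs k f" "\<And>v. f v \<noteq> 0"
  shows "Cs k (\<lambda>v. inverse (f v))"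
  using assms
proof (induction k arbitrary: f)
  case (Suc k)
  show ?case
  proof (rule Cs_SucI[where g' = "\<lambda>a v. - (inverse (f v) * pd a f v * inverse (f v))"])
    show "continuous_on UNIV (\<lambda>v. inverse (f v))"
      using Suc.prems by (intro continuous_intros Cs_continuous[OF Suc.prems(1)]) auto
    show "((\<lambda>x. inverse (f (v(a := x)))) has_real_derivative - (inverse (f v) * pd a f v * inverse (f v))) (at (v a))" for a v
      by (rule DERIV_cong[OF DERIV_inverse'[OF Cs_DERIV'[OF Suc.prems(1)]]]) (simp_all add: Suc.prems(2))
    show "Cs k (\<lambda>v. - (inverse (f v) * pd a f v * inverse (f v)))" for a
      using Suc Cs_SucD[OF Suc.prems(1)] by (intro Cs_minus Cs_mult Suc.IH Cs_pd) auto
  qed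
qed (auto intro: continuous_intros)

text \<open>The \<open>1\<close> counts variables: these are the k times continuously differentiable
  functions on the line, used as outer functions in compositions.\<close>

fun C1 :: "nat \<Rightarrow> (real \<Rightarrow> real) \<Rightarrow> bool" where
  "C1 0 h \<longleftrightarrow> continuous_on UNIV h"
| "C1 (Suc k) h \<longleftrightarrow> (\<exists>h'. (\<forall>x. (h has_real_derivative h' x) (at x)) \<and> C1 k h')"

lemma C1_continuous: "C1 k h \<Longrightarrow> continuous_on UNIV h"
  by (cases k) (auto intro!: continuous_at_imp_continuous_on dest: DERIV_isCont)

lemma Cs_compose:
  assumes "C1 k h" "Cs k g"
  shows "Cs k (\<lambda>v. h (g v))"
  using assms
proof (induction k arbitrary: h)
  case 0
  then show ?case by (auto intro: continuous_on_compose2)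
next
  case (Suc k)
  from Suc.prems obtain h' where h': "\<And>x. (h has_real_derivative h' x) (at x)" "C1 k h'"
    by auto
  show ?case
  proof (rule Cs_SucI[where g' = "\<lambda>a v. h' (g v) * pd a g v"])
    show "continuous_on UNIV (\<lambda>v. h (g v))"
      using continuous_on_compose2[OF C1_continuous[OF Suc.prems(1)] Cs_continuous[OF Suc.prems(2)]] by simp
    show "((\<lambda>x. h (g (v(a := x)))) has_real_derivative h' (g v) * pd a g v) (at (v a))" for a v
      by (rule DERIV_cong[OF DERIV_chain2[OF h'(1) Cs_DERIV'[OF Suc.prems(2)]]]) simp
    show "Cs k (\<lambda>v. h' (g v) * pd a g v)" for a
      by (rule Cs_mult[OF Suc.IH[OF h'(2) Cs_SucD[OF Suc.prems(2)]] Cs_pd[OF Suc.prems(2)]])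
  qed
qed

text \<open>Combinations of sine and cosine are closed under differentiation, which the induction
  needs; \<open>sin\<close> alone is not.\<close>

lemma C1_trig: "C1 k (\<lambda>x. p * sin x + q * cos x)"
proof (induction k arbitrary: p q)
  case 0
  then show ?case by (auto intro!: continuous_intros)
next
  case (Suc k)
  show ?case
    using Suc[of "-q" p] by (auto intro!: exI[of _ "\<lambda>x. - q * sin x + p * cos x"] derivative_eq_intros)
qed

lemma C1_sin: "C1 k sin" and C1_cos: "C1 k cos"
  using C1_trig[of k 1 0] C1_trig[of k 0 1] by simp_all

lemma C1_cmult: "C1 k h \<Longrightarrow> C1 k (\<lambda>x. c * h x)"
proof (induction k arbitrary: h)
  case 0
  then show ?case by (auto intro: continuous_intros)
next
  case (Suc k)
  then obtain h' where "\<And>x. (h has_real_derivative h' x) (at x)" "C1 k h'" by auto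
  then show ?case
    using Suc.IH by (auto intro!: exI[of _ "\<lambda>x. c * h' x"] DERIV_cmult)
qed

text \<open>Away from 0 the function is locally zero or a power. At 0 the difference quotient is
  bounded by the absolute value of \<open>h ^ Suc k\<close>. Such truncated powers serve as cut-offs
  of finite smoothness.\<close>

lemma DERIV_max_power:
  "((\<lambda>x::real. max 0 x ^ Suc (Suc k)) has_real_derivative real (Suc (Suc k)) * max 0 x ^ Suc k) (at x)"
proof -
  consider "x < 0" | "x > 0" | "x = 0" by linarith
  then show ?thesis
  proof cases
    case 1
    have ev: "\<forall>\<^sub>F y in nhds x. y < 0" using 1 by (rule eventually_nhds_in_open[OF open_lessThan, simplified])
    have "((\<lambda>x::real. 0) has_real_derivative 0) (at x)" by simp
    then have "((\<lambda>x::real. max 0 x ^ Suc (Suc k)) has_real_derivative 0) (at x)"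
      by (rule DERIV_cong_ev[THEN iffD1, rotated -1]) (use ev in \<open>auto elim!: eventually_mono\<close>)
    then show ?thesis using 1 by simp
  next
    case 2
    have ev: "\<forall>\<^sub>F y in nhds x. y > 0" using 2 by (rule eventually_nhds_in_open[OF open_greaterThan, simplified])
    have "((\<lambda>x::real. x ^ Suc (Suc k)) has_real_derivative real (Suc (Suc k)) * x ^ Suc k) (at x)"
      by (rule derivative_eq_intros refl)+ simp
    then have "((\<lambda>x::real. max 0 x ^ Suc (Suc k)) has_real_derivative real (Suc (Suc k)) * x ^ Suc k) (at x)"
      by (rule DERIV_cong_ev[THEN iffD1, rotated -1]) (use ev in \<open>auto elim!: eventually_mono\<close>)
    then show ?thesis using 2 by (simp add: max_def)
  next
    case 3
    have "((\<lambda>h::real. (max 0 h ^ Suc (Suc k)) / h) \<longlongrightarrow> 0) (at 0)"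
    proof (rule tendsto_0_le[where K = 1])
      show "((\<lambda>h::real. h ^ Suc k) \<longlongrightarrow> 0) (at 0)"
        by (auto intro!: tendsto_eq_intros)
      show "\<forall>\<^sub>F h in at 0. norm ((max 0 h ^ Suc (Suc k)) / h) \<le> norm (h ^ Suc k :: real) * 1"
        by (rule always_eventually, intro allI, case_tac "h \<le> 0") (simp_all add: max_def)
    qed
    then show ?thesis using 3 by (simp add: DERIV_def)
  qed
qed

lemma C1_max_power: "C1 k (\<lambda>x. max 0 x ^ Suc k)"
proof (induction k)
  case 0
  then show ?case by (auto intro!: continuous_intros)
next
  case (Suc k)
  show ?case unfolding C1.simps
    by (intro exI[of _ "\<lambda>x. real (Suc (Suc k)) * max 0 x ^ Suc k"] conjI allI C1_cmult Suc DERIV_max_power)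
qed

lemma continuous_on_update:
  "continuous_on UNIV (\<lambda>(v, x). v(a := x) :: 'i \<Rightarrow> real)"
  unfolding split_def
proof (rule continuous_on_coordinatewise_then_product)
  fix i
  have "(\<lambda>p::('i \<Rightarrow> real) \<times> real. ((fst p)(a := snd p)) i) = (if i = a then snd else (\<lambda>p. fst p i))"
    by (auto simp: fun_eq_iff)
  moreover have "continuous_on UNIV (\<lambda>p::('i \<Rightarrow> real) \<times> real. fst p i)"
    by (intro continuous_on_compose2[OF continuous_on_product_coordinates continuous_on_fst]) auto
  ultimately show "continuous_on UNIV (\<lambda>p::('i \<Rightarrow> real) \<times> real. ((fst p)(a := snd p)) i)"
    by (cases "i = a") (simp_all add: continuous_on_snd)
qed

lemma continuous_on_upd [continuous_intros]:
  assumes "continuous_on A f" "continuous_on A g"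
  shows "continuous_on A (\<lambda>p. (f p)(a := g p) :: 'i \<Rightarrow> real)"
  using continuous_on_compose2[OF continuous_on_update continuous_on_Pair[OF assms]] by simp

lemma continuous_on_comp_UNIV:
  "continuous_on UNIV g \<Longrightarrow> continuous_on A f \<Longrightarrow> continuous_on A (\<lambda>x. g (f x))"
  by (rule continuous_on_compose2) auto

text \<open>Differentiating \<open>h(x,y) = h(x,y\<^sub>0) + \<integral> h\<^sub>y(x,t) dt\<close> under the integral sign and then in \<open>y\<close>
  identifies the two mixed derivatives.\<close>

lemma pd_commute:
  assumes "Cs (Suc (Suc 0)) g"
  shows "pd a (pd b g) v = pd b (pd a g) v"
proof (cases "a = b")
  case False
  define y0 where "y0 = v b - 1"
  define y1 where "y1 = v b + 1"
  define P where "P x y = v(a := x, b := y)" for x y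
  have P': "P x y = v(b := y, a := x)" for x y
    using False by (auto simp: P_def fun_upd_twist)
  have Pv: "P (v a) (v b) = v" by (auto simp: P_def)
  have cP: "continuous_on S (\<lambda>p. P (f p) (h p))" if "continuous_on S f" "continuous_on S h"
    for S :: "'b::topological_space set" and f h
    unfolding P_def using that by (intro continuous_intros)
  have Ca: "Cs (Suc 0) (pd a g)" and Cb: "Cs (Suc 0) (pd b g)"
    using assms by (rule Cs_pd)+
  have cab: "continuous_on UNIV (pd a (pd b g))"
    using Cs_pd[OF Cb] by simp
  have d1: "((\<lambda>x. pd b g (P x y)) has_real_derivative pd a (pd b g) (P x y)) (at x)" for x y
    unfolding P' by (rule Cs_DERIV[OF Cb])
  have d2: "((\<lambda>y. pd a g (P x y)) has_real_derivative pd b (pd a g) (P x y)) (at y)" for x y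
    unfolding P_def by (rule Cs_DERIV[OF Ca])
  have d3: "((\<lambda>x. g (P x y)) has_real_derivative pd a g (P x y)) (at x)" for x y
    unfolding P' by (rule Cs_DERIV[OF assms])
  have d4: "((\<lambda>y. g (P x y)) has_real_derivative pd b g (P x y)) (at y)" for x y
    unfolding P_def by (rule Cs_DERIV[OF assms])
  have ftc: "integral {y0..y} (\<lambda>t. pd b g (P x t)) = g (P x y) - g (P x y0)" if "y0 \<le> y" for x y
    using that d4 by (intro integral_unique fundamental_theorem_of_calculus)
      (auto simp: has_real_derivative_iff_has_vector_derivative intro: has_vector_derivative_at_within)
  have key: "integral {y0..y} (\<lambda>t. pd a (pd b g) (P (v a) t)) = pd a g (P (v a) y) - pd a g (P (v a) y0)"
    if "y0 \<le> y" for y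
  proof (rule DERIV_unique)
    have "((\<lambda>x. integral (cbox y0 y) (\<lambda>t. pd b g (P x t))) has_field_derivative
        integral (cbox y0 y) (\<lambda>t. pd a (pd b g) (P (v a) t))) (at (v a) within UNIV)"
    proof (rule leibniz_rule_field_derivative)
      show "((\<lambda>x. pd b g (P x t)) has_real_derivative pd a (pd b g) (P x t)) (at x within UNIV)" for x t
        using d1 by simp
      show "(\<lambda>t. pd b g (P x t)) integrable_on cbox y0 y" for x
        by (intro integrable_continuous continuous_on_comp_UNIV[OF Cs_continuous[OF Cb]] cP continuous_intros)
      show "continuous_on (UNIV \<times> cbox y0 y) (\<lambda>(x, t). pd a (pd b g) (P x t))"
        unfolding split_def
        by (intro continuous_on_comp_UNIV[OF cab] cP continuous_intros)
    qed auto
    then show "((\<lambda>x. g (P x y) - g (P x y0)) has_real_derivative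
        integral {y0..y} (\<lambda>t. pd a (pd b g) (P (v a) t))) (at (v a))"
      using ftc[OF that] by simp
    show "((\<lambda>x. g (P x y) - g (P x y0)) has_real_derivative
        pd a g (P (v a) y) - pd a g (P (v a) y0)) (at (v a))"
      by (intro DERIV_diff d3)
  qed
  have "((\<lambda>y. integral {y0..y} (\<lambda>t. pd a (pd b g) (P (v a) t))) has_real_derivative
      pd a (pd b g) (P (v a) (v b))) (at (v b) within {y0..y1})"
    by (rule integral_has_real_derivative, intro continuous_on_comp_UNIV[OF cab] cP continuous_intros)
       (simp add: y0_def y1_def)
  then have "((\<lambda>y. pd a g (P (v a) y) - pd a g (P (v a) y0)) has_real_derivative
      pd a (pd b g) (P (v a) (v b))) (at (v b) within {y0..y1})"
    by (rule has_field_derivative_transform_within[of _ _ _ _ 1, OF _ _ _ key]) (auto simp: y0_def y1_def)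
  then have "((\<lambda>y. pd a g (P (v a) y) - pd a g (P (v a) y0)) has_real_derivative
      pd a (pd b g) (P (v a) (v b))) (at (v b))"
    by (subst (asm) at_within_interior) (auto simp: y0_def y1_def)
  moreover have "((\<lambda>y. pd a g (P (v a) y) - pd a g (P (v a) y0)) has_real_derivative
      pd b (pd a g) (P (v a) (v b)) - 0) (at (v b))"
    by (intro DERIV_diff d2 DERIV_const)
  ultimately show ?thesis
    using DERIV_unique Pv by fastforce
qed simp

section \<open>Iterated integrals over the unit cube\<close>

definition cint :: "'i \<Rightarrow> (('i \<Rightarrow> real) \<Rightarrow> real) \<Rightarrow> ('i \<Rightarrow> real) \<Rightarrow> real" where
  "cint a g v = integral {0..1} (\<lambda>x. g (v(a := x)))"

lemma continuous_cint:
  assumes "continuous_on UNIV g"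
  shows "continuous_on UNIV (cint a g)"
proof -
  have "continuous_on (UNIV \<times> cbox 0 (1::real)) (\<lambda>(v, x). g (v(a := x)))"
    unfolding split_def by (intro continuous_on_comp_UNIV[OF assms] continuous_intros)
  from integral_continuous_on_param[OF this] show ?thesis
    unfolding cint_def by simp
qed

lemma cint_commute:
  assumes "continuous_on UNIV g"
  shows "cint a (cint b g) = cint b (cint a g)"
proof (cases "a = b")
  case False
  have "cint a (cint b g) v = cint b (cint a g) v" for v
  proof -
    have "integral (cbox 0 1) (\<lambda>x. integral (cbox 0 1) (\<lambda>y. g (v(a := x, b := y)))) =
      integral (cbox 0 1) (\<lambda>y. integral (cbox 0 1) (\<lambda>x. g (v(a := x, b := y))))"
      by (rule integral_swap_continuous)
         (unfold split_def, intro continuous_on_comp_UNIV[OF assms] continuous_intros)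
    then show ?thesis
      using False by (simp add: cint_def fun_upd_twist)
  qed
  then show ?thesis by blast
qed simp

lemma integrable_slice:
  fixes g :: "('i \<Rightarrow> real) \<Rightarrow> real"
  shows "continuous_on UNIV g \<Longrightarrow> (\<lambda>x. g (v(a := x))) integrable_on {0..1::real}"
  by (rule integrable_continuous_real, rule continuous_on_comp_UNIV[of g], assumption, intro continuous_intros)

lemma cint_add:
  "continuous_on UNIV f \<Longrightarrow> continuous_on UNIV g \<Longrightarrow> cint a (\<lambda>v. f v + g v) = (\<lambda>v. cint a f v + cint a g v)"
  by (auto simp: cint_def fun_eq_iff integrable_slice intro!: integral_add)

lemma cint_const [simp]: "cint a (\<lambda>v. c) = (\<lambda>v. c)"
  by (auto simp: cint_def)

lemma cint_pd:
  assumes "Cs (Suc k) g"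
  shows "cint a (pd a g) v = g (v(a := 1)) - g (v(a := 0))"
  unfolding cint_def
  by (rule integral_unique, rule fundamental_theorem_of_calculus, simp, rule has_vector_derivative_at_within,
      rule Cs_DERIV[OF assms, unfolded has_real_derivative_iff_has_vector_derivative])

lemma continuous_foldr_cint: "continuous_on UNIV g \<Longrightarrow> continuous_on UNIV (foldr cint xs g)"
  by (induction xs) (auto intro: continuous_cint)

lemma foldr_cint_add:
  "continuous_on UNIV f \<Longrightarrow> continuous_on UNIV g \<Longrightarrow>
    foldr cint xs (\<lambda>v. f v + g v) = (\<lambda>v. foldr cint xs f v + foldr cint xs g v)"
  by (induction xs) (auto simp: cint_add continuous_foldr_cint)

lemma foldr_cint_const [simp]: "foldr cint xs (\<lambda>v. c) = (\<lambda>v. c)"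
  by (induction xs) auto

lemma foldr_cint_commute:
  "continuous_on UNIV g \<Longrightarrow> cint a (foldr cint xs g) = foldr cint xs (cint a g)"
  by (induction xs) (auto simp: cint_commute continuous_foldr_cint)

lemma foldr_cint_sum:
  "(\<And>i. i \<in> I \<Longrightarrow> continuous_on UNIV (f i)) \<Longrightarrow>
    foldr cint xs (\<lambda>v. \<Sum>i\<in>I. f i v) = (\<lambda>v. \<Sum>i\<in>I. foldr cint xs (f i) v)"
  by (induction I rule: infinite_finite_induct) (auto simp: foldr_cint_add continuous_on_sum)

text \<open>By Fubini the integration over \<open>a\<close> can be moved to the innermost place,
  where it already gives 0.\<close>

lemma foldr_cint_eq_0:
  assumes "a \<in> set xs" "continuous_on UNIV g" "\<And>v. cint a g v = 0"
  shows "foldr cint xs g v = 0"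
proof -
  obtain ys zs where xs: "xs = ys @ a # zs" using assms(1) by (meson split_list)
  have "cint a g = (\<lambda>v. 0)" using assms(3) by blast
  then show ?thesis
    by (simp add: xs foldr_cint_commute assms(2))
qed

type_synonym cfun = "(nat \<times> bool \<Rightarrow> real) \<Rightarrow> real"

lemma pd_cmult: "Cs (Suc k) f \<Longrightarrow> pd a (\<lambda>v. c * f v) v = c * pd a f v"
  using pd_mult[OF Cs_const[of "Suc k" c], of k f a v] by simp

lemma pd_cong_upd:
  assumes "\<And>v. g (v(a := x)) = g (v(a := y))" "b \<noteq> a"
  shows "pd b g (v(a := x)) = pd b g (v(a := y))"
proof -
  have "v(a := x, b := z) = v(b := z, a := x)" "v(a := y, b := z) = v(b := z, a := y)" for z
    using assms(2) by (auto simp: fun_upd_twist)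
  then show ?thesis
    using assms by (simp add: pd_def)
qed

lemma pd_eq_0_const: "(\<And>x. g (v(a := x)) = g v) \<Longrightarrow> pd a g v = 0"
  by (simp add: pd_def)

section \<open>Stokes' theorem for products of exact 2-forms\<close>

definition coords :: "nat \<Rightarrow> (nat \<times> bool) set" where
  "coords n = {..<n} \<times> UNIV"

lemma finite_coords [simp]: "finite (coords n)"
  by (simp add: coords_def)

lemma mem_coords [simp]: "(i, b) \<in> coords n \<longleftrightarrow> i < n"
  by (simp add: coords_def)

text \<open>The coefficient of \<open>dA\<^sub>1 \<and> \<dots> \<and> dA\<^sub>n\<close> with respect to the volume form, for 1-forms
  \<open>A\<^sub>i = \<Sum>\<^sub>b A i b dx\<^sub>b\<close>.\<close>

definition wedge :: "nat \<Rightarrow> (nat \<Rightarrow> nat \<times> bool \<Rightarrow> cfun) \<Rightarrow> cfun" where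
  "wedge n A v = (\<Sum>\<pi> | \<pi> permutes coords n. of_int (sign \<pi>) *
     (\<Prod>i<n. pd (\<pi> (i, False)) (A i (\<pi> (i, True))) v))"

text \<open>Reindexing by composition with the transposition turns the sum into its own
  negative.\<close>

lemma sum_sign_antisym:
  fixes X :: "('a \<Rightarrow> 'a) \<Rightarrow> real"
  assumes "finite S" "p \<in> S" "q \<in> S" "p \<noteq> q"
    and "\<And>\<pi>. \<pi> permutes S \<Longrightarrow> X (\<pi> \<circ> Transposition.transpose p q) = X \<pi>"
  shows "(\<Sum>\<pi> | \<pi> permutes S. of_int (sign \<pi>) * X \<pi>) = 0"
proof -
  have t: "Transposition.transpose p q permutes S"
    using assms by (intro permutes_swap_id)
  have "(\<Sum>\<pi> | \<pi> permutes S. of_int (sign \<pi>) * X \<pi>) =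
      (\<Sum>\<pi> | \<pi> permutes S. of_int (sign (\<pi> \<circ> Transposition.transpose p q)) * X (\<pi> \<circ> Transposition.transpose p q))"
    by (rule sum_permutations_compose_right[OF t])
  also have "\<dots> = (\<Sum>\<pi> | \<pi> permutes S. - (of_int (sign \<pi>) * X \<pi>))"
  proof (rule sum.cong[OF refl])
    fix \<pi> assume "\<pi> \<in> {\<pi>. \<pi> permutes S}"
    then have p: "\<pi> permutes S" by simp
    have "sign (\<pi> \<circ> Transposition.transpose p q) = - sign \<pi>"
      using permutes_imp_permutation[OF assms(1) p] assms(4)
      by (simp add: sign_compose permutation_swap_id sign_swap_id)
    then show "of_int (sign (\<pi> \<circ> Transposition.transpose p q)) * X (\<pi> \<circ> Transposition.transpose p q) = - (of_int (sign \<pi>) * X \<pi>)"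
      using assms(5)[OF p] by simp
  qed
  finally show ?thesis by (simp add: sum_negf)
qed

text \<open>The hypothesis says that the 2-form \<open>dA m\<close> vanishes at the single point
  \<open>v\<close>. Exchanging its two slots leaves every product unchanged and flips every
  sign.\<close>

lemma wedge_eq_0:
  assumes "m < n" "\<And>a b. pd a (A m b) v = pd b (A m a) v"
  shows "wedge n A v = 0"
  unfolding wedge_def
proof (rule sum_sign_antisym[where p = "(m, False)" and q = "(m, True)"])
  fix \<pi>
  let ?t = "Transposition.transpose (m, False) (m, True)"
  show "(\<Prod>i<n. pd ((\<pi> \<circ> ?t) (i, False)) (A i ((\<pi> \<circ> ?t) (i, True))) v) =
      (\<Prod>i<n. pd (\<pi> (i, False)) (A i (\<pi> (i, True))) v)"
  proof (rule prod.cong[OF refl])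
    fix i
    show "pd ((\<pi> \<circ> ?t) (i, False)) (A i ((\<pi> \<circ> ?t) (i, True))) v = pd (\<pi> (i, False)) (A i (\<pi> (i, True))) v"
      using assms(2) by (cases "i = m") (simp_all add: Transposition.transpose_def)
  qed
qed (use assms in auto)

lemma wedge_add_row:
  assumes "m < n" "\<And>b. Cs (Suc 0) (B b)" "\<And>b. Cs (Suc 0) (C b)"
  shows "wedge n (A(m := \<lambda>b v. B b v + C b v)) v = wedge n (A(m := B)) v + wedge n (A(m := C)) v"
proof -
  have split: "(\<Prod>i<n. pd (\<pi> (i, False)) ((A(m := R)) i (\<pi> (i, True))) v) =
      pd (\<pi> (m, False)) (R (\<pi> (m, True))) v * (\<Prod>i\<in>{..<n} - {m}. pd (\<pi> (i, False)) (A i (\<pi> (i, True))) v)"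
    for R \<pi>
    using assms(1) by (subst prod.remove[of _ m]) auto
  show ?thesis
    unfolding wedge_def split sum.distrib[symmetric]
    by (rule sum.cong[OF refl]) (simp add: pd_add[OF assms(2,3)] algebra_simps)
qed

text \<open>The boundary behaviour of a connection form pulled back from \<open>(P\<^sup>1)\<^sup>n\<close> to the cube:
  \<open>(j, True)\<close> is an angle, and the faces on which \<open>(j, False)\<close> is 0 or 1 are collapsed in the
  direction of that angle.\<close>

definition admissible :: "nat \<Rightarrow> (nat \<times> bool \<Rightarrow> cfun) \<Rightarrow> bool" where
  "admissible n R \<longleftrightarrow> (\<forall>b. Cs 2 (R b)) \<and>
     (\<forall>j<n. \<forall>b v. b \<noteq> (j, True) \<longrightarrow> R b (v((j, True) := 1)) = R b (v((j, True) := 0))) \<and>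
     (\<forall>j<n. \<forall>b v x. \<forall>\<tau>\<in>{0, 1}. fst b \<noteq> j \<longrightarrow>
        R b (v((j, False) := \<tau>, (j, True) := x)) = R b (v((j, False) := \<tau>))) \<and>
     (\<forall>j<n. \<forall>v w. \<forall>\<tau>\<in>{0, 1}. R (j, True) (v((j, False) := \<tau>)) = R (j, True) (w((j, False) := \<tau>)))"

text \<open>Models the difference of two connections on one bundle: a 1-form coming from (P^1)^n
  itself, so without longitude component at the poles.\<close>

definition null_row :: "nat \<Rightarrow> (nat \<times> bool \<Rightarrow> cfun) \<Rightarrow> bool" where
  "null_row n R \<longleftrightarrow> admissible n R \<and> (\<forall>j<n. \<forall>v. \<forall>\<tau>\<in>{0, 1}. R (j, True) (v((j, False) := \<tau>)) = 0)"

lemma admissible_Cs: "admissible n R \<Longrightarrow> Cs (Suc (Suc 0)) (R b)"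
  unfolding admissible_def numeral_2_eq_2 by (elim conjE) (drule spec)

lemma admissible_periodic:
  "admissible n R \<Longrightarrow> j < n \<Longrightarrow> b \<noteq> (j, True) \<Longrightarrow> R b (v((j, True) := 1)) = R b (v((j, True) := 0))"
  unfolding admissible_def by (elim conjE) metis

lemma admissible_face:
  "admissible n R \<Longrightarrow> j < n \<Longrightarrow> \<tau> \<in> {0, 1} \<Longrightarrow> fst b \<noteq> j \<Longrightarrow>
    R b (v((j, False) := \<tau>, (j, True) := x)) = R b (v((j, False) := \<tau>))"
  unfolding admissible_def by (elim conjE) metis

lemma admissible_face_const:
  "admissible n R \<Longrightarrow> j < n \<Longrightarrow> \<tau> \<in> {0, 1} \<Longrightarrow>
    R (j, True) (v((j, False) := \<tau>)) = R (j, True) (w((j, False) := \<tau>))"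
  unfolding admissible_def by (elim conjE) metis

lemma continuous_wedge:
  assumes "\<And>i. i < n \<Longrightarrow> admissible n (A i)"
  shows "continuous_on UNIV (wedge n A)"
proof -
  have "Cs (Suc 0) (\<lambda>v. \<Sum>\<pi> | \<pi> permutes coords n. of_int (sign \<pi>) *
     (\<Prod>i<n. pd (\<pi> (i, False)) (A i (\<pi> (i, True))) v))"
    using assms admissible_Cs
    by (intro Cs_sum Cs_mult Cs_const Cs_prod Cs_pd) blast
  from Cs_continuous[OF this] show ?thesis
    by (simp add: wedge_def[abs_def])
qed

text \<open>The integrand is d of \<open>A m\<close> wedged with the other \<open>dA i\<close>, so
  each summand integrates to a difference between two opposite faces. Longitude faces agree by
  periodicity; on the pole faces the coefficients vanish because the longitude is collapsed
  there.\<close>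

lemma integral_wedge_null_row:
  assumes "m < n" "\<And>i. i < n \<Longrightarrow> admissible n (A i)" "null_row n (A m)" "set xs = coords n"
  shows "foldr cint xs (wedge n A) v = 0"
proof -
  define I where "I = {..<n} - {m}"
  have finI: "finite I" by (simp add: I_def)
  have In: "i < n" "i \<noteq> m" if "i \<in> I" for i using that by (auto simp: I_def)
  define F where "F \<pi> i = pd (\<pi> (i, False)) (A i (\<pi> (i, True)))" for \<pi> i
  \<comment> \<open>Unsigned coefficient of the (2n-1)-form \<open>A m\<close> wedged with the other
    \<open>dA i\<close>; the direction \<open>\<pi> (m, False)\<close> is the one left out.\<close>
  define G where "G \<pi> v = A m (\<pi> (m, True)) v * (\<Prod>i\<in>I. F \<pi> i v)" for \<pi> v
  define H where "H \<pi> v = of_int (sign \<pi>) * G \<pi> v" for \<pi> v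
  have CA: "Cs (Suc (Suc 0)) (A i b)" if "i < n" for i b
    using assms(2)[OF that] by (rule admissible_Cs)
  have CF: "Cs (Suc 0) (F \<pi> i)" if "i \<in> I" for \<pi> i
    unfolding F_def using In[OF that] by (intro Cs_pd CA)
  have CP: "Cs (Suc 0) (\<lambda>v. \<Prod>i\<in>I. F \<pi> i v)" for \<pi>
    by (intro Cs_prod CF)
  have CG: "Cs (Suc 0) (G \<pi>)" for \<pi>
    unfolding G_def[abs_def] by (intro Cs_mult CP Cs_SucD[OF CA] assms(1))
  have CH: "Cs (Suc 0) (H \<pi>)" for \<pi>
    unfolding H_def[abs_def] by (intro Cs_mult CG Cs_const)
  have pdH: "pd (\<pi> (m, False)) (H \<pi>) v = of_int (sign \<pi>) * (\<Prod>i<n. F \<pi> i v) +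
      (\<Sum>i\<in>I. of_int (sign \<pi>) * (A m (\<pi> (m, True)) v *
        (pd (\<pi> (m, False)) (F \<pi> i) v * (\<Prod>k\<in>I - {i}. F \<pi> k v))))" for \<pi> v
  proof -
    have "pd (\<pi> (m, False)) (H \<pi>) v = of_int (sign \<pi>) * pd (\<pi> (m, False)) (G \<pi>) v"
      unfolding H_def[abs_def] by (rule pd_cmult[OF CG])
    also have "pd (\<pi> (m, False)) (G \<pi>) v = F \<pi> m v * (\<Prod>i\<in>I. F \<pi> i v) +
        A m (\<pi> (m, True)) v * pd (\<pi> (m, False)) (\<lambda>v. \<Prod>i\<in>I. F \<pi> i v) v"
      unfolding G_def[abs_def] F_def[of \<pi> m] by (rule pd_mult[OF CA[OF assms(1)] CP])
    also have "F \<pi> m v * (\<Prod>i\<in>I. F \<pi> i v) = (\<Prod>i<n. F \<pi> i v)"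
      unfolding I_def using assms(1) by (subst prod.remove[of "{..<n}" m]) auto
    also have "pd (\<pi> (m, False)) (\<lambda>v. \<Prod>i\<in>I. F \<pi> i v) v =
        (\<Sum>i\<in>I. pd (\<pi> (m, False)) (F \<pi> i) v * (\<Prod>k\<in>I - {i}. F \<pi> k v))"
      by (rule pd_prod[OF finI CF])
    finally show ?thesis
      by (simp only: distrib_left sum_distrib_left)
  qed
  \<comment> \<open>This is d d = 0: both differentiations hit \<open>A i\<close>, they commute, and
    swapping their slots flips the sign.\<close>
  have cancel: "(\<Sum>\<pi> | \<pi> permutes coords n. of_int (sign \<pi>) * (A m (\<pi> (m, True)) v *
        (pd (\<pi> (m, False)) (F \<pi> i) v * (\<Prod>k\<in>I - {i}. F \<pi> k v)))) = 0" if "i \<in> I" for i v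
  proof (rule sum_sign_antisym[where p = "(m, False)" and q = "(i, False)"])
    fix \<pi>
    let ?t = "Transposition.transpose (m, False) (i, False)"
    have "A m ((\<pi> \<circ> ?t) (m, True)) = A m (\<pi> (m, True))"
      by (simp add: Transposition.transpose_def)
    moreover have "pd ((\<pi> \<circ> ?t) (m, False)) (F (\<pi> \<circ> ?t) i) v = pd (\<pi> (m, False)) (F \<pi> i) v"
      unfolding F_def using pd_commute[OF CA[OF In(1)[OF that]]] by (simp add: Transposition.transpose_def)
    moreover have "(\<Prod>k\<in>I - {i}. F (\<pi> \<circ> ?t) k v) = (\<Prod>k\<in>I - {i}. F \<pi> k v)"
      by (rule prod.cong[OF refl]) (auto simp: F_def Transposition.transpose_def I_def)
    ultimately show "A m ((\<pi> \<circ> ?t) (m, True)) v *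
        (pd ((\<pi> \<circ> ?t) (m, False)) (F (\<pi> \<circ> ?t) i) v * (\<Prod>k\<in>I - {i}. F (\<pi> \<circ> ?t) k v)) =
        A m (\<pi> (m, True)) v * (pd (\<pi> (m, False)) (F \<pi> i) v * (\<Prod>k\<in>I - {i}. F \<pi> k v))"
      by simp
  qed (use In[OF that] assms(1) in auto)
  have "wedge n A v = (\<Sum>\<pi> | \<pi> permutes coords n. pd (\<pi> (m, False)) (H \<pi>) v)" for v
  proof -
    have "(\<Sum>\<pi> | \<pi> permutes coords n. pd (\<pi> (m, False)) (H \<pi>) v) = wedge n A v +
      (\<Sum>\<pi> | \<pi> permutes coords n. \<Sum>i\<in>I. of_int (sign \<pi>) * (A m (\<pi> (m, True)) v *
        (pd (\<pi> (m, False)) (F \<pi> i) v * (\<Prod>k\<in>I - {i}. F \<pi> k v))))"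
      unfolding pdH sum.distrib by (simp add: wedge_def F_def)
    also have "\<dots> = wedge n A v"
      by (subst sum.swap) (simp add: cancel)
    finally show ?thesis by simp
  qed
  then have W: "wedge n A = (\<lambda>v. \<Sum>\<pi> | \<pi> permutes coords n. pd (\<pi> (m, False)) (H \<pi>) v)"
    by blast
  \<comment> \<open>The longitude \<open>(j, True)\<close> fills exactly one slot other than
    \<open>(m, False)\<close>. If it is the component of \<open>A m\<close>, that is 0 on the face.
    If it is the component of another \<open>A i\<close>, that is constant on the face and is
    differentiated along it. If it is a direction of differentiation, the component differentiated
    does not depend on the collapsed longitude.\<close>
  have vanish: "G \<pi> (v((j, False) := \<tau>)) = 0"
    if pi: "\<pi> permutes coords n" and j: "\<pi> (m, False) = (j, False)" "j < n" and tau: "\<tau> \<in> {0, 1}" for \<pi> v j \<tau>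
  proof -
    have inj: "\<pi> p = \<pi> q \<longleftrightarrow> p = q" for p q
      using permutes_inj[OF pi] by (auto dest: injD)
    obtain i b where ib: "\<pi> (i, b) = (j, True)" "i < n"
      using permutes_image[OF pi] j(2) by (metis imageE mem_coords surj_pair)
    show ?thesis
    proof (cases "i = m")
      case True
      with ib j have "b = True" by (cases b) auto
      then have "A m (\<pi> (m, True)) (v((j, False) := \<tau>)) = 0"
        using assms(3) ib True j tau unfolding null_row_def by auto
      then show ?thesis by (simp add: G_def)
    next
      case False
      then have iI: "i \<in> I" using ib by (simp add: I_def)
      have "F \<pi> i (v((j, False) := \<tau>)) = 0"
      proof (cases b)
        case True
        have "\<pi> (i, False) \<noteq> (j, False)"
          using inj[of "(i, False)" "(m, False)"] j False by auto
        then have "pd (\<pi> (i, False)) (A i (j, True)) (v((j, False) := \<tau>)) = 0"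
          by (intro pd_eq_0_const, subst fun_upd_twist)
             (auto intro: admissible_face_const[OF assms(2)[OF ib(2)] j(2) tau])
        then show ?thesis using ib True by (simp add: F_def)
      next
        case b: False
        have "\<pi> (i, True) \<noteq> (j, False)" "\<pi> (i, True) \<noteq> (j, True)"
          using inj[of "(i, True)" "(m, False)"] inj[of "(i, True)" "(i, False)"] j False ib b by auto
        then have "fst (\<pi> (i, True)) \<noteq> j"
          by (metis (full_types) prod.collapse)
        then have "pd (j, True) (A i (\<pi> (i, True))) (v((j, False) := \<tau>)) = 0"
          by (intro pd_eq_0_const admissible_face[OF assms(2)[OF ib(2)] j(2) tau])
        then show ?thesis using ib b by (simp add: F_def)
      qed
      then have "(\<Prod>i\<in>I. F \<pi> i (v((j, False) := \<tau>))) = 0"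
        using iI finI by (auto simp: prod_zero_iff)
      then show ?thesis by (simp add: G_def)
    qed
  qed
  have faces: "G \<pi> (v(\<pi> (m, False) := 1)) = G \<pi> (v(\<pi> (m, False) := 0))"
    if pi: "\<pi> permutes coords n" for \<pi> v
  proof -
    have inj: "\<pi> p = \<pi> q \<longleftrightarrow> p = q" for p q
      using permutes_inj[OF pi] by (auto dest: injD)
    obtain j b where jb: "\<pi> (m, False) = (j, b)" by fastforce
    have j: "j < n"
      using permutes_in_image[OF pi, of "(m, False)"] assms(1) jb by simp
    show ?thesis
    proof (cases b)
      case True
      \<comment> \<open>The direction \<open>(j, True)\<close> is taken by the slot
        \<open>(m, False)\<close>, so it occurs in no other slot and periodicity passes to all
        factors and their derivatives.\<close>
      have per: "A i b (w((j, True) := 1)) = A i b (w((j, True) := 0))" if "i < n" "b \<noteq> (j, True)" for i b w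
        by (rule admissible_periodic[OF assms(2)[OF that(1)] j that(2)])
      have ne: "\<pi> p \<noteq> (j, True)" if "p \<noteq> (m, False)" for p
        using inj[of p "(m, False)"] that jb True by auto
      have "F \<pi> i (v((j, True) := 1)) = F \<pi> i (v((j, True) := 0))" if "i \<in> I" for i
        unfolding F_def using In[OF that] by (intro pd_cong_upd per ne) auto
      then have "(\<Prod>i\<in>I. F \<pi> i (v((j, True) := 1))) = (\<Prod>i\<in>I. F \<pi> i (v((j, True) := 0)))"
        by (intro prod.cong refl)
      moreover have "A m (\<pi> (m, True)) (v((j, True) := 1)) = A m (\<pi> (m, True)) (v((j, True) := 0))"
        using assms(1) by (intro per ne) auto
      ultimately show ?thesis using jb True by (simp add: G_def)
    next
      case False
      then show ?thesis
        using vanish[OF pi _ j, of 0] vanish[OF pi _ j, of 1] jb by simp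
    qed
  qed
  have cH: "continuous_on UNIV (pd a (H \<pi>))" for a \<pi>
    using Cs_pd[OF CH] by simp
  have "foldr cint xs (wedge n A) v =
      (\<Sum>\<pi> | \<pi> permutes coords n. foldr cint xs (pd (\<pi> (m, False)) (H \<pi>)) v)"
    unfolding W by (subst foldr_cint_sum) (auto intro: cH)
  also have "\<dots> = 0"
  proof (rule sum.neutral, intro ballI)
    fix \<pi> assume "\<pi> \<in> {\<pi>. \<pi> permutes coords n}"
    then have pi: "\<pi> permutes coords n" by simp
    show "foldr cint xs (pd (\<pi> (m, False)) (H \<pi>)) v = 0"
    proof (rule foldr_cint_eq_0[OF _ cH])
      show "\<pi> (m, False) \<in> set xs"
        using permutes_in_image[OF pi, of "(m, False)"] assms(1,4) by simp
      show "cint (\<pi> (m, False)) (pd (\<pi> (m, False)) (H \<pi>)) v = 0" for v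
        by (simp add: cint_pd[OF CH] H_def faces[OF pi])
    qed
  qed
  finally show ?thesis .
qed

lemma integral_wedge_cong:
  assumes "\<And>i. i < n \<Longrightarrow> admissible n (A i)" "\<And>i. i < n \<Longrightarrow> admissible n (C i)"
    and "\<And>i. i < n \<Longrightarrow> null_row n (\<lambda>b v. A i b v - C i b v)" "set xs = coords n"
  shows "foldr cint xs (wedge n A) v = foldr cint xs (wedge n C) v"
proof -
  \<comment> \<open>Hybrids with \<open>A\<close> in the rows below \<open>m\<close>. Consecutive
    ones differ by a wedge whose row \<open>m\<close> is the null row \<open>A m - C m\<close>, so
    their integrals agree.\<close>
  define K where "K m = (\<lambda>i. if i < m then A i else C i)" for m
  have "foldr cint xs (wedge n (K m)) v = foldr cint xs (wedge n C) v" if "m \<le> n" for m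
    using that
  proof (induction m)
    case (Suc m)
    then have m: "m < n" by simp
    let ?D = "\<lambda>b v. A m b v - C m b v"
    let ?L = "(K m)(m := ?D)"
    have adK: "admissible n (K m i)" if "i < n" for i
      using assms that by (simp add: K_def)
    have adL: "admissible n (?L i)" if "i < n" for i
      using adK[OF that] assms(3)[OF m] by (simp add: null_row_def)
    have C0: "Cs (Suc 0) (C m b)" "Cs (Suc 0) (?D b)" for b
      using admissible_Cs[OF assms(2)[OF m]] admissible_Cs[of n ?D] assms(3)[OF m] Cs_SucD
      unfolding null_row_def by blast+
    have K: "(K m)(m := \<lambda>b v. C m b v + ?D b v) = K (Suc m)" "(K m)(m := C m) = K m"
      by (auto simp: K_def fun_eq_iff)
    have "wedge n (K (Suc m)) = (\<lambda>v. wedge n (K m) v + wedge n ?L v)"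
      using wedge_add_row[where B = "C m" and C = ?D and A = "K m", OF m C0, unfolded K] by (rule ext)
    then have "foldr cint xs (wedge n (K (Suc m))) v = foldr cint xs (wedge n (K m)) v + foldr cint xs (wedge n ?L) v"
      using continuous_wedge[of n "K m", OF adK] continuous_wedge[of n ?L, OF adL]
      by (simp add: foldr_cint_add)
    also have "foldr cint xs (wedge n ?L) v = 0"
      by (rule integral_wedge_null_row[OF m adL _ assms(4)]) (simp_all add: assms(3)[OF m])
    finally show ?case using Suc by simp
  qed (simp add: K_def)
  from this[of n] have "foldr cint xs (wedge n (K n)) v = foldr cint xs (wedge n C) v" by simp
  moreover have "wedge n (K n) = wedge n A"
    by (auto simp: wedge_def K_def fun_eq_iff intro!: sum.cong prod.cong)
  ultimately show ?thesis by simp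
qed

section \<open>The wedge product for the standard connections\<close>

lemma sign_map_prod:
  assumes "\<sigma> permutes {..<n}"
  shows "sign (map_prod \<sigma> (id :: bool \<Rightarrow> bool)) = 1 \<and> map_prod \<sigma> (id :: bool \<Rightarrow> bool) permutes coords n"
  using assms finite_lessThan
proof (induction rule: permutes_induct)
  case id
  then show ?case by (simp add: map_prod.id permutes_id sign_id del: id_apply)
next
  case (swap a b p)
  let ?P = "map_prod p (id :: bool \<Rightarrow> bool)"
  let ?s = "Transposition.transpose (a, True) (b, True)"
  let ?t = "Transposition.transpose (a, False) (b, False)"
  \<comment> \<open>A transposition of indices becomes two transpositions of coordinates, so the
    sign stays 1.\<close>
  have eq: "map_prod (Transposition.transpose a b \<circ> p) (id :: bool \<Rightarrow> bool) = ?s \<circ> (?t \<circ> ?P)"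
    by (auto simp: fun_eq_iff Transposition.transpose_def split: if_splits)
  have perm: "permutation ?P" "permutation ?s" "permutation ?t"
    using swap.IH by (auto simp only: permutation_swap_id intro: permutes_imp_permutation[OF finite_coords])
  have "sign (?s \<circ> (?t \<circ> ?P)) = 1"
    using swap.IH swap.hyps perm by (simp add: sign_compose permutation_compose sign_swap_id del: id_apply)
  moreover have "(?s \<circ> (?t \<circ> ?P)) permutes coords n"
    using swap.IH swap.hyps by (intro permutes_compose permutes_swap_id) (auto simp del: id_apply)
  ultimately show ?case unfolding eq by blast
qed

text \<open>Row \<open>i\<close> is the form \<open>\<Sum>j. e i j * t j\<close> d\<theta>_j, with
  latitude t_j and longitude \<theta>_j. Its only nonzero derivatives are those of a longitude
  component along the latitude with the same index. A permutation that contributes therefore moves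
  such pairs as a whole; it is a doubled permutation of indices and has sign 1, which gives a
  permanent instead of a determinant.\<close>

lemma wedge_standard:
  assumes "\<And>i j. C i (j, True) = (\<lambda>v. e i j * v (j, False))" "\<And>i j. C i (j, False) = (\<lambda>v. 0)"
  shows "wedge n C v = (\<Sum>\<sigma> | \<sigma> permutes {..<n}. \<Prod>i<n. e i (\<sigma> i))"
proof -
  have pdC: "pd a (C i b) v = (if snd b \<and> a = (fst b, False) then e i (fst b) else 0)" for a i b
  proof (cases "snd b")
    case True
    then obtain j where b: "b = (j, True)" by (cases b) auto
    show ?thesis
    proof (cases "a = (j, False)")
      case True
      then show ?thesis unfolding b assms
        by (intro pd_eqI) (auto intro!: derivative_eq_intros)
    next
      case False
      then show ?thesis unfolding b assms
        by (intro pd_eqI) auto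
    qed
  next
    case False
    then obtain j where b: "b = (j, False)" by (cases b) auto
    show ?thesis by (simp add: b assms)
  qed
  let ?f = "\<lambda>\<sigma>. map_prod \<sigma> (id :: bool \<Rightarrow> bool)"
  let ?T = "\<lambda>\<pi>. of_int (sign \<pi>) * (\<Prod>i<n. pd (\<pi> (i, False)) (C i (\<pi> (i, True))) v)"
  have inj: "inj_on ?f {\<sigma>. \<sigma> permutes {..<n}}"
  proof (rule inj_onI)
    fix \<sigma> \<rho> assume "?f \<sigma> = ?f \<rho>"
    then have "?f \<sigma> (x, True) = ?f \<rho> (x, True)" for x by simp
    then show "\<sigma> = \<rho>" by (simp add: fun_eq_iff)
  qed
  have sub: "?f ` {\<sigma>. \<sigma> permutes {..<n}} \<subseteq> {\<pi>. \<pi> permutes coords n}"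
    using sign_map_prod by auto
  have zero: "?T \<pi> = 0" if "\<pi> permutes coords n" "\<pi> \<notin> ?f ` {\<sigma>. \<sigma> permutes {..<n}}" for \<pi>
  proof (rule ccontr)
    assume "?T \<pi> \<noteq> 0"
    then have nz: "\<And>i. i < n \<Longrightarrow> pd (\<pi> (i, False)) (C i (\<pi> (i, True))) v \<noteq> 0"
      by auto
    define \<sigma> where "\<sigma> i = (if i < n then fst (\<pi> (i, True)) else i)" for i
    have T: "\<pi> (i, True) = (\<sigma> i, True)" and F: "\<pi> (i, False) = (\<sigma> i, False)" if "i < n" for i
      using nz[OF that] that by (auto simp: pdC \<sigma>_def split: if_splits intro: prod_eqI)
    have out: "\<pi> (i, b) = (i, b)" if "\<not> i < n" for i b
      using permutes_not_in[OF \<open>\<pi> permutes coords n\<close>] that by simp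
    have "\<pi> (i, b) = ?f \<sigma> (i, b)" for i b
    proof (cases "i < n")
      case True
      then show ?thesis by (cases b) (simp_all add: T F)
    next
      case False
      then show ?thesis using out[OF False] by (simp add: \<sigma>_def)
    qed
    then have pi: "\<pi> = ?f \<sigma>" by (auto simp: fun_eq_iff)
    have "inj_on \<sigma> {..<n}"
    proof (rule inj_onI)
      fix i j assume "i \<in> {..<n}" "j \<in> {..<n}" "\<sigma> i = \<sigma> j"
      then have "\<pi> (i, True) = \<pi> (j, True)" using T by simp
      then show "i = j" using permutes_inj[OF that(1)] by (auto dest: injD)
    qed
    moreover have "\<sigma> ` {..<n} \<subseteq> {..<n}"
    proof
      fix y assume "y \<in> \<sigma> ` {..<n}"
      then obtain i where i: "i < n" "y = \<sigma> i" by auto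
      then show "y \<in> {..<n}"
        using permutes_in_image[OF that(1), of "(i, True)"] T by simp
    qed
    ultimately have "bij_betw \<sigma> {..<n} {..<n}"
      by (simp add: bij_betw_def endo_inj_surj)
    then have "\<sigma> permutes {..<n}"
      by (rule bij_imp_permutes) (simp add: \<sigma>_def)
    then show False using pi that by blast
  qed
  have "wedge n C v = (\<Sum>\<pi>\<in>?f ` {\<sigma>. \<sigma> permutes {..<n}}. ?T \<pi>)"
    unfolding wedge_def
    by (rule sum.mono_neutral_right) (use sub zero in \<open>auto simp: finite_permutations\<close>)
  also have "\<dots> = (\<Sum>\<sigma> | \<sigma> permutes {..<n}. ?T (?f \<sigma>))"
    by (subst sum.reindex[OF inj]) simp
  also have "\<dots> = (\<Sum>\<sigma> | \<sigma> permutes {..<n}. \<Prod>i<n. e i (\<sigma> i))"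
    by (rule sum.cong[OF refl]) (simp add: sign_map_prod pdC)
  finally show ?thesis .
qed

section \<open>Common zeros of sections\<close>

lemma admissibleI:
  assumes "\<And>b. Cs 2 (R b)"
    and "\<And>j b v. j < n \<Longrightarrow> b \<noteq> (j, True) \<Longrightarrow> R b (v((j, True) := 1)) = R b (v((j, True) := 0))"
    and "\<And>j b v x \<tau>. j < n \<Longrightarrow> \<tau> \<in> {0, 1} \<Longrightarrow> fst b \<noteq> j \<Longrightarrow>
        R b (v((j, False) := \<tau>, (j, True) := x)) = R b (v((j, False) := \<tau>))"
    and "\<And>j v w \<tau>. j < n \<Longrightarrow> \<tau> \<in> {0, 1} \<Longrightarrow>
        R (j, True) (v((j, False) := \<tau>)) = R (j, True) (w((j, False) := \<tau>))"
  shows "admissible n R"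
  unfolding admissible_def
  by (intro conjI allI ballI impI; rule assms; assumption)

text \<open>Where K M = 1, the form C + K (u dw - w du - M C) reduces to (u dw - w du) / (u^2 +
  w^2), the differential of an argument, hence closed. The variables are the values at one point of
  the functions and their derivatives along a and b: \<open>Cab\<close> is the a-derivative of the
  b-component of C, \<open>Cba\<close> the reverse.\<close>

lemma curvature_identity:
  fixes k u w ua ub wa wb uab wab ka kb M Ma Mb Ca Cb Cab Cba :: real
  assumes "k * M = 1" "ka * M + k * Ma = 0" "kb * M + k * Mb = 0"
    and "M = u * u + w * w" "Ma = 2 * (u * ua + w * wa)" "Mb = 2 * (u * ub + w * wb)"
  shows "Cab + (ka * (u * wb - w * ub - M * Cb) +
      k * (ua * wb + u * wab - (wa * ub + w * uab) - (Ma * Cb + M * Cab))) =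
    Cba + (kb * (u * wa - w * ua - M * Ca) +
      k * (ub * wa + u * wab - (wb * ua + w * uab) - (Mb * Ca + M * Cba)))" (is "?l = ?r")
proof -
  have inv: "x = - (k * k * y)" if "x * M + k * y = 0" for x y
  proof -
    have "x = x * (k * M)" using assms(1) by simp
    also have "\<dots> = k * (x * M)" by (simp add: algebra_simps)
    also have "x * M = - (k * y)" using that by linarith
    finally show ?thesis by simp
  qed
  have ka: "ka = - (k * k * Ma)" and kb: "kb = - (k * k * Mb)"
    using inv assms(2,3) by blast+
  \<comment> \<open>The terms without a Jacobian of u and w cancel, and the rest carries the factor
    M = u^2 + w^2, which K absorbs.\<close>
  have 1: "ka * (u * wb - w * ub) - kb * (u * wa - w * ua) = - 2 * (k * M) * k * (ua * wb - wa * ub)"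
    unfolding ka kb assms(4,5,6) by (simp add: algebra_simps)
  have 2: "k * M * Cab = Cab" "k * M * Cba = Cba"
    "(ka * M + k * Ma) * Cb = 0" "(kb * M + k * Mb) * Ca = 0"
    using assms by simp_all
  have 3: "ka * (u * wb - w * ub) - kb * (u * wa - w * ua) = - 2 * k * (ua * wb - wa * ub)"
    using 1 unfolding assms(1) by simp
  have "?l - ?r = (Cab - k * M * Cab) - (Cba - k * M * Cba) - (ka * M + k * Ma) * Cb + (kb * M + k * Mb) * Ca +
      ((ka * (u * wb - w * ub) - kb * (u * wa - w * ua)) + 2 * k * (ua * wb - wa * ub))"
    by (simp add: algebra_simps)
  also have "\<dots> = 0" unfolding 2 3 by simp
  finally show ?thesis by simp
qed

text \<open>The pair \<open>u i\<close>, \<open>w i\<close> is the real and imaginary part of a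
  section. At latitude \<tau> = 0 it does not depend on the longitude x, at \<tau> = 1 it turns by
  the angle \<open>e i j * x\<close>: this is the transition function that records the degree of the
  bundle in direction \<open>j\<close>.\<close>

theorem common_zero:
  fixes u w :: "nat \<Rightarrow> cfun" and e :: "nat \<Rightarrow> nat \<Rightarrow> real"
  assumes Cu: "\<And>i. Cs (Suc 2) (u i)" and Cw: "\<And>i. Cs (Suc 2) (w i)"
    and peru: "\<And>i j v. i < n \<Longrightarrow> j < n \<Longrightarrow> u i (v((j, True) := 1)) = u i (v((j, True) := 0))"
    and perw: "\<And>i j v. i < n \<Longrightarrow> j < n \<Longrightarrow> w i (v((j, True) := 1)) = w i (v((j, True) := 0))"
    and faceu: "\<And>i j v x \<tau>. i < n \<Longrightarrow> j < n \<Longrightarrow> \<tau> \<in> {0, 1} \<Longrightarrow>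
      u i (v((j, False) := \<tau>, (j, True) := x)) =
        cos (e i j * \<tau> * x) * u i (v((j, False) := \<tau>, (j, True) := 0)) -
        sin (e i j * \<tau> * x) * w i (v((j, False) := \<tau>, (j, True) := 0))"
    and facew: "\<And>i j v x \<tau>. i < n \<Longrightarrow> j < n \<Longrightarrow> \<tau> \<in> {0, 1} \<Longrightarrow>
      w i (v((j, False) := \<tau>, (j, True) := x)) =
        sin (e i j * \<tau> * x) * u i (v((j, False) := \<tau>, (j, True) := 0)) +
        cos (e i j * \<tau> * x) * w i (v((j, False) := \<tau>, (j, True) := 0))"
    and perm: "(\<Sum>\<sigma> | \<sigma> permutes {..<n}. \<Prod>i<n. e i (\<sigma> i)) \<noteq> 0"
  shows "\<exists>v. \<forall>i<n. u i v = 0 \<and> w i v = 0"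
proof (rule ccontr)
  assume "\<nexists>v. \<forall>i<n. u i v = 0 \<and> w i v = 0"
  then have nz: "\<exists>i<n. u i v \<noteq> 0 \<or> w i v \<noteq> 0" for v by blast
  define M where "M i v = u i v * u i v + w i v * w i v" for i v
  define N where "N v = (\<Sum>i<n. M i v)" for v
  \<comment> \<open>Below 1/n, so by averaging the \<open>n\<close> values \<open>M i v\<close>
    cannot all be at most \<open>\<delta> * N v\<close>.\<close>
  define \<delta> where "\<delta> = 1 / (real n + 1)"
  \<comment> \<open>a positive twice differentiable function that agrees with \<open>M i\<close> where \<open>M i\<close> is not small;
    there \<open>A i\<close> below is the differential of the argument of \<open>u i + \<i> w i\<close>, hence flat\<close>
  define Q where "Q i v = M i v + max 0 (\<delta> * N v - M i v) ^ Suc 2" for i v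
  define K where "K i v = inverse (Q i v)" for i v
  define C :: "nat \<Rightarrow> nat \<times> bool \<Rightarrow> cfun" where
    "C i b v = (if snd b then e i (fst b) * v (fst b, False) else 0)" for i b v
  \<comment> \<open>M times the difference between the differential of the argument and the standard
    connection; the factor M makes it meaningful at zeros of the section as well. With K in place of
    1/M, \<open>A i\<close> is defined everywhere.\<close>
  define L where "L i b v = u i v * pd b (w i) v - w i v * pd b (u i) v - M i v * C i b v" for i b v
  define B where "B i b v = K i v * L i b v" for i b v
  define A where "A i b v = C i b v + B i b v" for i b v

  have M0: "M i v \<ge> 0" for i v by (simp add: M_def)
  have N0: "N v > 0" for v
  proof -
    obtain i where "i < n" "u i v \<noteq> 0 \<or> w i v \<noteq> 0" using nz by blast
    then have "0 < M i v" unfolding M_def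
      by (metis add_nonneg_pos add_pos_nonneg not_real_square_gt_zero zero_le_square)
    also have "M i v \<le> N v" unfolding N_def using \<open>i < n\<close> M0 by (intro member_le_sum) auto
    finally show ?thesis .
  qed
  have d0: "\<delta> > 0" by (simp add: \<delta>_def)
  have Q0: "Q i v > 0" for i v
  proof (cases "M i v = 0")
    case True
    then show ?thesis using N0[of v] d0 by (simp add: Q_def)
  next
    case False
    then have "M i v > 0" using M0[of i v] by simp
    then show ?thesis unfolding Q_def by (intro add_pos_nonneg) auto
  qed
  have big: "\<exists>i<n. M i v > \<delta> * N v" for v
  proof (rule ccontr)
    assume "\<not> ?thesis"
    then have "M i v \<le> \<delta> * N v" if "i < n" for i
      using that by (meson not_less)
    then have "N v \<le> (\<Sum>i<n. \<delta> * N v)"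
      unfolding N_def[of v] by (intro sum_mono) (simp add: N_def)
    also have "\<dots> = (real n * \<delta>) * N v" by simp
    also have "\<dots> < 1 * N v" by (intro mult_strict_right_mono N0) (simp add: \<delta>_def)
    finally show False by simp
  qed

  have Cu2: "Cs 2 (u i)" and Cw2: "Cs 2 (w i)" for i
    using Cs_SucD[OF Cu] Cs_SucD[OF Cw] by blast+
  have Cpu: "Cs 2 (pd b (u i))" and Cpw: "Cs 2 (pd b (w i))" for i b
    by (intro Cs_pd Cu Cw)+
  have CM: "Cs 2 (M i)" for i
    unfolding M_def[abs_def] by (intro Cs_add Cs_mult Cu2 Cw2)
  have CN: "Cs 2 N"
    unfolding N_def[abs_def] by (intro Cs_sum CM)
  have CQ: "Cs 2 (Q i)" for i
    unfolding Q_def[abs_def]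
    by (intro Cs_add CM Cs_compose[OF C1_max_power[of 2]] Cs_diff Cs_mult Cs_const CN)
  have CK: "Cs 2 (K i)" for i
    unfolding K_def[abs_def] using Q0[of i] by (intro Cs_inverse CQ) (simp add: less_le)
  have CC: "Cs 2 (C i b)" for i b
    unfolding C_def[abs_def] by (cases "snd b") (auto intro!: Cs_mult Cs_coord)
  have CL: "Cs 2 (L i b)" for i b
    unfolding L_def[abs_def] by (intro Cs_diff Cs_mult Cu2 Cw2 Cpu Cpw CM CC)
  have CB: "Cs 2 (B i b)" for i b
    unfolding B_def[abs_def] by (intro Cs_mult CK CL)
  have CA: "Cs 2 (A i b)" for i b
    unfolding A_def[abs_def] by (intro Cs_add CC CB)
  have S: "Cs (Suc (Suc 0)) g" if "Cs 2 g" for g :: cfun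
    using that unfolding numeral_2_eq_2 .
  note S1 = S[THEN Cs_SucD]

  have flat: "pd a (A i b) v = pd b (A i a) v" if big: "M i v > \<delta> * N v" for i v a b
  proof -
    have pdM: "pd a (M i) v = 2 * (u i v * pd a (u i) v + w i v * pd a (w i) v)" for a
    proof -
      have "pd a (M i) v = pd a (\<lambda>v. u i v * u i v) v + pd a (\<lambda>v. w i v * w i v) v"
        unfolding M_def[abs_def]
        by (rule pd_add[OF Cs_mult[OF S1[OF Cu2] S1[OF Cu2]] Cs_mult[OF S1[OF Cw2] S1[OF Cw2]]])
      then show ?thesis
        by (simp add: pd_mult[OF S1[OF Cu2] S1[OF Cu2]] pd_mult[OF S1[OF Cw2] S1[OF Cw2]])
    qed
    have KM: "K i z * M i z = 1" if "M i z > \<delta> * N z" for z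
      using that Q0[of i z] by (simp add: K_def Q_def)
    have pdKM: "pd a (K i) v * M i v + K i v * pd a (M i) v = 0" for a
    proof -
      \<comment> \<open>The condition on \<open>M i\<close> is open, so K M = 1 holds near
        \<open>v a\<close> along the whole coordinate line and may be differentiated.\<close>
      have cont: "continuous_on UNIV (\<lambda>x. M i (v(a := x)) - \<delta> * N (v(a := x)))"
        by (intro continuous_intros continuous_on_comp_UNIV[OF Cs_continuous[OF CM]]
              continuous_on_comp_UNIV[OF Cs_continuous[OF CN]])
      have "open {x. 0 < M i (v(a := x)) - \<delta> * N (v(a := x))}"
        by (rule open_Collect_less[OF continuous_on_const cont])
      then have "\<forall>\<^sub>F x in nhds (v a). x \<in> {x. 0 < M i (v(a := x)) - \<delta> * N (v(a := x))}"
        by (rule eventually_nhds_in_open) (use big in simp)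
      then have ev: "\<forall>\<^sub>F x in nhds (v a). K i (v(a := x)) * M i (v(a := x)) = 1"
        by eventually_elim (auto intro: KM)
      have "((\<lambda>x. K i (v(a := x)) * M i (v(a := x))) has_real_derivative 0) (at (v a))"
        by (subst DERIV_cong_ev[OF refl ev refl]) simp
      then have "pd a (\<lambda>v. K i v * M i v) v = 0" by (rule pd_eqI)
      then show ?thesis using pd_mult[OF S1[OF CK] S1[OF CM]] by simp
    qed
    have pdA: "pd a (A i b) v = pd a (C i b) v + (pd a (K i) v * (u i v * pd b (w i) v - w i v * pd b (u i) v - M i v * C i b v) +
      K i v * (pd a (u i) v * pd b (w i) v + u i v * pd a (pd b (w i)) v -
         (pd a (w i) v * pd b (u i) v + w i v * pd a (pd b (u i)) v) -
         (pd a (M i) v * C i b v + M i v * pd a (C i b) v)))" for a b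
    proof -
      have "pd a (A i b) v = pd a (C i b) v + pd a (B i b) v"
        unfolding A_def[abs_def] by (rule pd_add[OF S1[OF CC] S1[OF CB]])
      also have "pd a (B i b) v = pd a (K i) v * L i b v + K i v * pd a (L i b) v"
        unfolding B_def[abs_def] by (rule pd_mult[OF S1[OF CK] S1[OF CL]])
      also have "pd a (L i b) v = pd a (\<lambda>v. u i v * pd b (w i) v - w i v * pd b (u i) v) v - pd a (\<lambda>v. M i v * C i b v) v"
        unfolding L_def[abs_def]
        by (rule pd_diff[OF Cs_diff[OF Cs_mult[OF S1[OF Cu2] S1[OF Cpw]] Cs_mult[OF S1[OF Cw2] S1[OF Cpu]]]
              Cs_mult[OF S1[OF CM] S1[OF CC]]])
      also have "pd a (\<lambda>v. u i v * pd b (w i) v - w i v * pd b (u i) v) v =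
          pd a (\<lambda>v. u i v * pd b (w i) v) v - pd a (\<lambda>v. w i v * pd b (u i) v) v"
        by (rule pd_diff[OF Cs_mult[OF S1[OF Cu2] S1[OF Cpw]] Cs_mult[OF S1[OF Cw2] S1[OF Cpu]]])
      finally show ?thesis
        by (simp only: pd_mult[OF S1[OF Cu2] S1[OF Cpw]] pd_mult[OF S1[OF Cw2] S1[OF Cpu]]
              pd_mult[OF S1[OF CM] S1[OF CC]] L_def)
    qed
    have comm: "pd b (pd a (u i)) v = pd a (pd b (u i)) v" "pd b (pd a (w i)) v = pd a (pd b (w i)) v"
      using pd_commute[OF S[OF Cu2]] pd_commute[OF S[OF Cw2]] by blast+
    show ?thesis
      unfolding pdA[of a b] pdA[of b a] comm
      by (rule curvature_identity[OF KM[OF big] pdKM pdKM _ pdM pdM]) (simp add: M_def)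
  qed

  have adC: "admissible n (C i)" for i
    by (rule admissibleI[OF CC]) (auto simp: C_def prod_eq_iff)

  have nullB: "null_row n (B i)" if i: "i < n" for i
  proof -
    \<comment> \<open>On a pole face the longitude only rotates the section, which preserves its
      modulus.\<close>
    have faceM: "M k (v((j, False) := \<tau>, (j, True) := x)) = M k (v((j, False) := \<tau>, (j, True) := 0))"
      if "j < n" "\<tau> \<in> {0, 1}" "k < n" for k v j \<tau> x
    proof -
      define U where "U = u k (v((j, False) := \<tau>, (j, True) := 0))"
      define W where "W = w k (v((j, False) := \<tau>, (j, True) := 0))"
      define s where "s = sin (e k j * \<tau> * x)"
      define c where "c = cos (e k j * \<tau> * x)"
      have "s * s + c * c = 1" by (simp add: s_def c_def flip: power2_eq_square)
      moreover have "(c * U - s * W) * (c * U - s * W) + (s * U + c * W) * (s * U + c * W) =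
          (s * s + c * c) * (U * U + W * W)"
        by (simp add: algebra_simps)
      ultimately show ?thesis
        unfolding M_def faceu[OF that(3,1,2), of v x] facew[OF that(3,1,2), of v x]
        by (simp add: U_def W_def s_def c_def)
    qed
    have faceN: "N (v((j, False) := \<tau>, (j, True) := x)) = N (v((j, False) := \<tau>, (j, True) := 0))"
      if "j < n" "\<tau> \<in> {0, 1}" for v j \<tau> x
      unfolding N_def by (rule sum.cong[OF refl], rule faceM[OF that]) simp
    have faceK: "K i (v((j, False) := \<tau>, (j, True) := x)) = K i (v((j, False) := \<tau>, (j, True) := 0))"
      if "j < n" "\<tau> \<in> {0, 1}" for v j \<tau> x
      unfolding K_def Q_def faceM[OF that i, of v x] faceN[OF that, of v x] ..
    \<comment> \<open>The rotation does not depend on the coordinate \<open>b\<close>, so u dw - w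
      du is invariant under it in that direction.\<close>
    have faceB: "B i b (v((j, False) := \<tau>, (j, True) := x)) = B i b (v((j, False) := \<tau>, (j, True) := 0))"
      if j: "j < n" "\<tau> \<in> {0, 1}" and b: "fst b \<noteq> j" for v j \<tau> x b
    proof -
      let ?p = "\<lambda>x v. v((j, False) := \<tau>, (j, True) := x)"
      have tw: "(?p x v)(b := z) = ?p x (v(b := z))" for x z
        using b by (auto simp: fun_eq_iff)
      have vb: "v b = (?p y v) b" for y
        using b by (auto simp: prod_eq_iff)
      define U where "U = u i (?p 0 v)"
      define W where "W = w i (?p 0 v)"
      define U' where "U' = pd b (u i) (?p 0 v)"
      define W' where "W' = pd b (w i) (?p 0 v)"
      define s where "s = sin (e i j * \<tau> * x)"
      define c where "c = cos (e i j * \<tau> * x)"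
      have du: "((\<lambda>z. u i ((?p 0 v)(b := z))) has_real_derivative U') (at (v b))"
        unfolding U'_def vb[of 0] by (rule Cs_DERIV'[OF Cu])
      have dw: "((\<lambda>z. w i ((?p 0 v)(b := z))) has_real_derivative W') (at (v b))"
        unfolding W'_def vb[of 0] by (rule Cs_DERIV'[OF Cw])
      have eu: "(\<lambda>z. u i ((?p x v)(b := z))) = (\<lambda>z. c * u i ((?p 0 v)(b := z)) - s * w i ((?p 0 v)(b := z)))"
        unfolding tw c_def s_def by (rule ext, rule faceu[OF i j])
      have ew: "(\<lambda>z. w i ((?p x v)(b := z))) = (\<lambda>z. s * u i ((?p 0 v)(b := z)) + c * w i ((?p 0 v)(b := z)))"
        unfolding tw c_def s_def by (rule ext, rule facew[OF i j])
      have pu: "pd b (u i) (?p x v) = c * U' - s * W'"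
        by (rule pd_eqI, unfold eu vb[of x, symmetric]) (intro DERIV_diff DERIV_cmult du dw)
      have pw: "pd b (w i) (?p x v) = s * U' + c * W'"
        by (rule pd_eqI, unfold ew vb[of x, symmetric]) (intro DERIV_add DERIV_cmult du dw)
      have sc: "s * s + c * c = 1" by (simp add: s_def c_def flip: power2_eq_square)
      have "(c * U - s * W) * (s * U' + c * W') - (s * U + c * W) * (c * U' - s * W') =
          (s * s + c * c) * (U * W' - W * U')"
        by (simp add: algebra_simps)
      then have "u i (?p x v) * pd b (w i) (?p x v) - w i (?p x v) * pd b (u i) (?p x v) = U * W' - W * U'"
        unfolding pu pw faceu[OF i j, of v x] facew[OF i j, of v x] sc
        by (simp add: U_def W_def s_def c_def)
      moreover have "C i b (?p x v) = C i b (?p 0 v)"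
        using b by (auto simp: C_def)
      ultimately show ?thesis
        unfolding B_def L_def faceM[OF j i, of v x] faceK[OF j, of v x]
        by (simp add: U_def W_def U'_def W'_def)
    qed
    \<comment> \<open>On a pole face the argument grows along the longitude at rate
      \<open>e i j * \<tau>\<close>, which is exactly the coefficient of the standard connection
      there.\<close>
    have zeroB: "B i (j, True) (v((j, False) := \<tau>)) = 0" if j: "j < n" "\<tau> \<in> {0, 1}" for v j \<tau>
    proof -
      let ?p = "\<lambda>x. v((j, False) := \<tau>, (j, True) := x)"
      define x where "x = v (j, True)"
      have vp: "v((j, False) := \<tau>) = ?p x" by (auto simp: x_def fun_eq_iff)
      have upd: "(?p x)((j, True) := z) = ?p z" for z by simp
      define U where "U = u i (?p 0)"
      define W where "W = w i (?p 0)"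
      define q where "q = e i j * \<tau>"
      have fu: "u i (?p z) = cos (q * z) * U - sin (q * z) * W" for z
        unfolding U_def W_def q_def by (rule faceu[OF i j])
      have fw: "w i (?p z) = sin (q * z) * U + cos (q * z) * W" for z
        unfolding U_def W_def q_def by (rule facew[OF i j])
      have px: "(?p x) (j, True) = x" by simp
      have "((\<lambda>z. cos (q * z) * U - sin (q * z) * W) has_real_derivative
          - q * (sin (q * x) * U + cos (q * x) * W)) (at x)"
        by (auto intro!: derivative_eq_intros simp: algebra_simps)
      then have "pd (j, True) (u i) (?p x) = - (e i j * \<tau>) * w i (?p x)"
        by (intro pd_eqI, unfold upd px fu fw, unfold q_def)
      moreover have "((\<lambda>z. sin (q * z) * U + cos (q * z) * W) has_real_derivative
          q * (cos (q * x) * U - sin (q * x) * W)) (at x)"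
        by (auto intro!: derivative_eq_intros simp: algebra_simps)
      then have "pd (j, True) (w i) (?p x) = (e i j * \<tau>) * u i (?p x)"
        by (intro pd_eqI, unfold upd px fu fw, unfold q_def)
      moreover have "C i (j, True) (?p x) = e i j * \<tau>" by (simp add: C_def)
      ultimately have "L i (j, True) (?p x) = 0"
        by (simp only: L_def M_def) (simp add: algebra_simps)
      then show ?thesis by (subst vp) (simp only: B_def mult_zero_right)
    qed
    have perB: "B i b (v((j, True) := 1)) = B i b (v((j, True) := 0))" if j: "j < n" and b: "b \<noteq> (j, True)" for j b v
    proof -
      have perM: "M k (v((j, True) := 1)) = M k (v((j, True) := 0))" if "k < n" for k v
        by (simp only: M_def peru[OF that j] perw[OF that j])
      have perN: "N (v((j, True) := 1)) = N (v((j, True) := 0))" for v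
        unfolding N_def by (rule sum.cong[OF refl], rule perM) simp
      have "C i b (v((j, True) := 1)) = C i b (v((j, True) := 0))"
        by (simp add: C_def)
      then show ?thesis
        unfolding B_def K_def Q_def L_def perM[OF i] perN peru[OF i j] perw[OF i j]
          pd_cong_upd[OF peru[OF i j] b] pd_cong_upd[OF perw[OF i j] b] by simp
    qed
    have "admissible n (B i)"
    proof (rule admissibleI[OF CB perB])
      fix j x and b :: "nat \<times> bool" and v :: "nat \<times> bool \<Rightarrow> real" and \<tau> :: real assume j: "j < n" "\<tau> \<in> {0, 1}" and b: "fst b \<noteq> j"
      have "v((j, False) := \<tau>) = v((j, False) := \<tau>, (j, True) := v (j, True))"
        by (auto simp: fun_eq_iff)
      then show "B i b (v((j, False) := \<tau>, (j, True) := x)) = B i b (v((j, False) := \<tau>))"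
        using faceB[OF j b] by metis
    next
      fix j and v w :: "nat \<times> bool \<Rightarrow> real" and \<tau> :: real assume "j < n" "\<tau> \<in> {0, 1}"
      then show "B i (j, True) (v((j, False) := \<tau>)) = B i (j, True) (w((j, False) := \<tau>))"
        by (simp only: zeroB)
    qed
    then show ?thesis unfolding null_row_def using zeroB by blast
  qed
  have adA: "admissible n (A i)" if i: "i < n" for i
  proof -
    have adB: "admissible n (B i)" using nullB[OF i] by (simp add: null_row_def)
    show ?thesis
    proof (rule admissibleI[OF CA])
      fix j b v assume jb: "j < n" "b \<noteq> (j, True)"
      show "A i b (v((j, True) := 1)) = A i b (v((j, True) := 0))"
        unfolding A_def admissible_periodic[OF adC jb] admissible_periodic[OF adB jb] ..
    next
      fix j x and b :: "nat \<times> bool" and v :: "nat \<times> bool \<Rightarrow> real" and \<tau> :: real assume jb: "j < n" "\<tau> \<in> {0, 1}" "fst b \<noteq> j"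
      show "A i b (v((j, False) := \<tau>, (j, True) := x)) = A i b (v((j, False) := \<tau>))"
        unfolding A_def admissible_face[OF adC jb] admissible_face[OF adB jb] ..
    next
      fix j and v w :: "nat \<times> bool \<Rightarrow> real" and \<tau> :: real assume j: "j < n" "\<tau> \<in> {0, 1}"
      show "A i (j, True) (v((j, False) := \<tau>)) = A i (j, True) (w((j, False) := \<tau>))"
        unfolding A_def using admissible_face_const[OF adC j] admissible_face_const[OF adB j] by metis
    qed
  qed
  have diff: "(\<lambda>b v. A i b v - C i b v) = B i" for i
    by (auto simp: A_def fun_eq_iff)
  obtain xs where xs: "set xs = coords n" using finite_list[OF finite_coords] by blast
  have "foldr cint xs (wedge n A) (\<lambda>_. 0) = foldr cint xs (wedge n C) (\<lambda>_. 0)"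
    by (rule integral_wedge_cong[OF adA adC _ xs]) (simp_all only: diff nullB)
  moreover have "wedge n A = (\<lambda>v. 0)"
  proof
    fix v
    obtain i where "i < n" "M i v > \<delta> * N v" using big by blast
    then show "wedge n A v = 0" using flat by (intro wedge_eq_0[of i])
  qed
  moreover have "wedge n C = (\<lambda>v. \<Sum>\<sigma> | \<sigma> permutes {..<n}. \<Prod>i<n. e i (\<sigma> i))"
    by (rule ext, rule wedge_standard) (simp_all add: C_def fun_eq_iff)
  ultimately show False using perm by simp
qed

section \<open>Permanents of sign matrices\<close>

text \<open>Permutations with the same restriction to \<open>T\<close> form a coset of the
  permutations of \<open>S - T\<close>, and \<open>F\<close> is constant on each coset.\<close>

lemma sum_permutations_dvd:
  fixes F :: "('a \<Rightarrow> 'a) \<Rightarrow> int"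
  assumes "finite S" "T \<subseteq> S"
    and F: "\<And>\<sigma> \<tau>. \<sigma> permutes S \<Longrightarrow> \<tau> permutes S \<Longrightarrow> (\<forall>i\<in>T. \<sigma> i = \<tau> i) \<Longrightarrow> F \<sigma> = F \<tau>"
  shows "int (fact (card S - card T)) dvd (\<Sum>\<sigma> | \<sigma> permutes S. F \<sigma>)"
proof -
  let ?P = "{\<sigma>. \<sigma> permutes S}"
  let ?r = "\<lambda>\<sigma>. restrict \<sigma> T"
  have fin: "finite ?P" using assms(1) by (rule finite_permutations)
  have fib: "int (fact (card S - card T)) dvd (\<Sum>\<sigma> | \<sigma> \<in> ?P \<and> ?r \<sigma> = ?r \<tau>. F \<sigma>)" if tau: "\<tau> permutes S" for \<tau>
  proof -
    have eq: "{\<sigma>. \<sigma> \<in> ?P \<and> ?r \<sigma> = ?r \<tau>} = (\<lambda>\<rho>. \<tau> \<circ> \<rho>) ` {\<rho>. \<rho> permutes (S - T)}"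
    proof (intro equalityI subsetI)
      fix \<sigma> assume "\<sigma> \<in> {\<sigma>. \<sigma> \<in> ?P \<and> ?r \<sigma> = ?r \<tau>}"
      then have s: "\<sigma> permutes S" "?r \<sigma> = ?r \<tau>" by auto
      have T: "\<sigma> i = \<tau> i" if "i \<in> T" for i
        using fun_cong[OF s(2), of i] that by simp
      define \<rho> where "\<rho> = inv \<tau> \<circ> \<sigma>"
      have "\<rho> permutes S"
        unfolding \<rho>_def using s(1) tau by (intro permutes_compose permutes_inv)
      moreover have "\<rho> i = i" if "i \<in> T" for i
        using T[OF that] permutes_inverses(2)[OF tau] by (simp add: \<rho>_def)
      ultimately have "\<rho> permutes (S - T)"
        by (rule permutes_superset) auto
      moreover have "\<sigma> = \<tau> \<circ> \<rho>"
        using permutes_inverses(1)[OF tau] by (auto simp: \<rho>_def fun_eq_iff)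
      ultimately show "\<sigma> \<in> (\<lambda>\<rho>. \<tau> \<circ> \<rho>) ` {\<rho>. \<rho> permutes (S - T)}" by blast
    next
      fix \<sigma> assume "\<sigma> \<in> (\<lambda>\<rho>. \<tau> \<circ> \<rho>) ` {\<rho>. \<rho> permutes (S - T)}"
      then obtain \<rho> where r: "\<rho> permutes (S - T)" "\<sigma> = \<tau> \<circ> \<rho>" by blast
      have "\<rho> permutes S" using r(1) by (rule permutes_subset) auto
      then have "\<sigma> permutes S" using r(2) tau by (simp add: permutes_compose)
      moreover have "?r \<sigma> = ?r \<tau>"
        using permutes_not_in[OF r(1)] r(2) by (auto simp: restrict_def)
      ultimately show "\<sigma> \<in> {\<sigma>. \<sigma> \<in> ?P \<and> ?r \<sigma> = ?r \<tau>}" by simp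
    qed
    have "inj_on (\<lambda>\<rho>. \<tau> \<circ> \<rho>) {\<rho>. \<rho> permutes (S - T)}"
      using permutes_inj[OF tau] by (auto intro!: inj_onI simp: fun_eq_iff inj_eq)
    then have "card {\<sigma>. \<sigma> \<in> ?P \<and> ?r \<sigma> = ?r \<tau>} = card {\<rho>. \<rho> permutes (S - T)}"
      unfolding eq by (rule card_image)
    also have "\<dots> = fact (card S - card T)"
      using assms by (intro card_permutations) (auto simp: card_Diff_subset finite_subset)
    finally have card: "card {\<sigma>. \<sigma> \<in> ?P \<and> ?r \<sigma> = ?r \<tau>} = fact (card S - card T)" .
    have "(\<Sum>\<sigma> | \<sigma> \<in> ?P \<and> ?r \<sigma> = ?r \<tau>. F \<sigma>) = (\<Sum>\<sigma> | \<sigma> \<in> ?P \<and> ?r \<sigma> = ?r \<tau>. F \<tau>)"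
    proof (rule sum.cong[OF refl])
      fix \<sigma> assume "\<sigma> \<in> {\<sigma>. \<sigma> \<in> ?P \<and> ?r \<sigma> = ?r \<tau>}"
      then have s: "\<sigma> permutes S" "?r \<sigma> = ?r \<tau>" by auto
      have "\<sigma> i = \<tau> i" if "i \<in> T" for i
        using fun_cong[OF s(2), of i] that by simp
      with s(1) show "F \<sigma> = F \<tau>" using F tau by blast
    qed
    also have "\<dots> = int (fact (card S - card T)) * F \<tau>"
      unfolding sum_constant card by simp
    finally show ?thesis by (simp only: dvd_triv_left)
  qed
  have "(\<Sum>\<sigma>\<in>?P. F \<sigma>) = (\<Sum>t\<in>?r ` ?P. \<Sum>\<sigma> | \<sigma> \<in> ?P \<and> ?r \<sigma> = t. F \<sigma>)"
    by (rule sum.image_gen[OF fin])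
  also have "int (fact (card S - card T)) dvd \<dots>"
    by (rule dvd_sum) (use fib in auto)
  finally show ?thesis .
qed

section \<open>Powers of two in factorials\<close>

lemma fact_double_odd: "\<exists>c. odd c \<and> (fact (2 * q) :: nat) = 2 ^ q * fact q * c"
proof (induction q)
  case 0
  show ?case by (intro exI[of _ 1]) simp
next
  case (Suc q)
  then obtain c where c: "odd c" "(fact (2 * q) :: nat) = 2 ^ q * fact q * c" by blast
  have "fact (2 * Suc q) = (2 * Suc q) * ((2 * q + 1) * (fact (2 * q) :: nat))"
    by (simp add: algebra_simps)
  also have "\<dots> = 2 ^ Suc q * fact (Suc q) * ((2 * q + 1) * c)"
    unfolding c(2) by (simp add: algebra_simps)
  finally show ?case using c(1) by (intro exI[of _ "(2 * q + 1) * c"]) auto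
qed

lemma pow2_dvd_fact_double: "2 ^ q * fact q dvd (fact (2 * q) :: nat)"
  using fact_double_odd[of q] by auto

text \<open>By Legendre the exponent of 2 in n! is n minus the binary digit sum, which is k for n =
  2^k - 1. The factor \<open>2 ^ k\<close> avoids subtraction in the exponent.\<close>

lemma fact_mersenne: "\<exists>c. odd c \<and> 2 ^ k * (fact (2 ^ k - 1) :: nat) = 2 ^ (2 ^ k - 1) * c"
proof (induction k)
  case 0
  show ?case by (intro exI[of _ 1]) simp
next
  case (Suc k)
  define q where "q = (2 ^ k - 1 :: nat)"
  have n: "2 ^ Suc k - 1 = Suc (2 * q)"
  proof -
    have "(1::nat) \<le> 2 ^ k" by simp
    then show ?thesis unfolding q_def power_Suc by linarith
  qed
  obtain c where c: "odd c" "2 ^ k * (fact q :: nat) = 2 ^ q * c" using Suc unfolding q_def by blast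
  obtain d where d: "odd d" "(fact (2 * q) :: nat) = 2 ^ q * fact q * d" using fact_double_odd by blast
  have "2 ^ Suc k * (fact (Suc (2 * q)) :: nat) = 2 * Suc (2 * q) * 2 ^ q * (2 ^ k * fact q) * d"
    unfolding fact_Suc d(2) by (simp only: power_Suc of_nat_id ac_simps)
  also have "\<dots> = 2 ^ Suc (2 * q) * (Suc (2 * q) * c * d)"
    unfolding c(2) power_Suc mult_2[of q] power_add by (simp only: ac_simps)
  finally show ?case unfolding n using c(1) d(1) by (intro exI[of _ "Suc (2 * q) * c * d"]) auto
qed

text \<open>Below 2^k - 1 the binary digit sum is at most k - 1, one less than in the extreme case.
  The induction drops the last binary digit of \<open>m\<close>.\<close>

lemma pow2_dvd_fact:
  assumes "m < 2 ^ k - 1"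
  shows "2 ^ Suc m dvd 2 ^ k * (fact m :: nat)"
  using assms
proof (induction k arbitrary: m)
  case (Suc k)
  define q where "q = m div 2"
  \<comment> \<open>For even \<open>m\<close> the half may equal 2^k - 1, where only the weaker
    bound holds; it suffices then. For odd \<open>m\<close> the half is strictly smaller.\<close>
  have qle: "2 ^ q dvd 2 ^ k * (fact q :: nat)" and qlt: "q < 2 ^ k - 1 \<Longrightarrow> 2 ^ Suc q dvd 2 ^ k * (fact q :: nat)"
  proof -
    show "2 ^ Suc q dvd 2 ^ k * (fact q :: nat)" if "q < 2 ^ k - 1" using Suc.IH[OF that] .
    have "q \<le> 2 ^ k - 1" using Suc.prems unfolding q_def power_Suc by linarith
    then consider "q < 2 ^ k - 1" | "q = 2 ^ k - 1" by linarith
    then show "2 ^ q dvd 2 ^ k * (fact q :: nat)"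
    proof cases
      case 1
      then show ?thesis using Suc.IH[OF 1] by (metis dvd_trans le_imp_power_dvd lessI less_imp_le)
    next
      case 2
      then show ?thesis using fact_mersenne[of k] by auto
    qed
  qed
  show ?case
  proof (cases "even m")
    case True
    then have m: "m = 2 * q" by (simp add: q_def)
    have "2 ^ Suc m = 2 * 2 ^ q * (2 ^ q :: nat)"
      by (simp add: m mult_2 power_add distrib_right)
    also have "(2::nat) * 2 ^ q * 2 ^ q dvd 2 * 2 ^ q * (2 ^ k * fact q)"
      using qle by (intro mult_dvd_mono dvd_refl)
    also have "\<dots> = 2 ^ Suc k * (2 ^ q * fact q)" by (simp add: algebra_simps)
    also have "\<dots> dvd 2 ^ Suc k * fact m"
      unfolding m by (intro mult_dvd_mono dvd_refl pow2_dvd_fact_double)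
    finally show ?thesis .
  next
    case False
    then have m: "m = Suc (2 * q)" by (simp add: q_def)
    have "q < 2 ^ k - 1" using Suc.prems unfolding m power_Suc by linarith
    have "2 ^ Suc m = 2 * 2 ^ q * (2 ^ Suc q :: nat)"
      by (simp add: m mult_2 power_add distrib_left distrib_right)
    also have "\<dots> dvd 2 * 2 ^ q * (2 ^ k * fact q)"
      using qlt[OF \<open>q < 2 ^ k - 1\<close>] by (intro mult_dvd_mono dvd_refl)
    also have "\<dots> = 2 ^ Suc k * (2 ^ q * fact q)" by (simp add: algebra_simps)
    also have "\<dots> dvd 2 ^ Suc k * fact (2 * q)"
      by (intro mult_dvd_mono dvd_refl pow2_dvd_fact_double)
    also have "\<dots> dvd 2 ^ Suc k * fact m"
      unfolding m by (intro mult_dvd_mono dvd_refl fact_dvd) simp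
    finally show ?thesis .
  qed
qed simp

text \<open>Writing the matrix as \<open>J - 2B\<close> with \<open>B\<close> a 0/1 matrix, the permanent is
  \<open>\<Sum>\<^sub>T (-2)^|T| (n-|T|)! p\<^sub>T\<close> with integers \<open>p\<^sub>T\<close>; for \<open>n = 2^k - 1\<close> the 2-adic valuation
  of the term \<open>n!\<close> for \<open>T = {}\<close> is strictly smaller than that of all the others.\<close>

theorem permanent_sign_matrix_nonzero:
  fixes e :: "nat \<Rightarrow> nat \<Rightarrow> int"
  assumes n: "n = 2 ^ k - 1" and e: "\<And>i j. e i j \<in> {1, - 1}"
  shows "(\<Sum>\<sigma> | \<sigma> permutes {..<n}. \<Prod>i<n. e i (\<sigma> i)) \<noteq> 0"
proof
  assume zero: "(\<Sum>\<sigma> | \<sigma> permutes {..<n}. \<Prod>i<n. e i (\<sigma> i)) = 0"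
  define b :: "nat \<Rightarrow> nat \<Rightarrow> int" where "b i j = (if e i j = 1 then 0 else - 2)" for i j
  define t where "t T = (\<Sum>\<sigma> | \<sigma> permutes {..<n}. \<Prod>i\<in>T. b i (\<sigma> i))" for T
  have eb: "e i j = b i j + 1" for i j
    using e[of i j] by (auto simp: b_def)
  have "(\<Sum>\<sigma> | \<sigma> permutes {..<n}. \<Prod>i<n. e i (\<sigma> i)) =
      (\<Sum>\<sigma> | \<sigma> permutes {..<n}. \<Sum>T\<in>Pow {..<n}. \<Prod>i\<in>T. b i (\<sigma> i))"
    unfolding eb by (subst prod_add) simp_all
  also have "\<dots> = (\<Sum>T\<in>Pow {..<n}. t T)"
    unfolding t_def by (rule sum.swap)
  also have "\<dots> = t {} + (\<Sum>T\<in>Pow {..<n} - {{}}. t T)"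
    by (rule sum.remove) auto
  finally have "t {} = - (\<Sum>T\<in>Pow {..<n} - {{}}. t T)" using zero by linarith
  moreover have "t {} = int (fact n)"
    by (simp add: t_def card_permutations[OF card_lessThan])
  moreover have "2 ^ Suc n dvd 2 ^ k * (\<Sum>T\<in>Pow {..<n} - {{}}. t T)"
    unfolding sum_distrib_left
  proof (rule dvd_sum)
    fix T assume "T \<in> Pow {..<n} - {{}}"
    then have T: "T \<subseteq> {..<n}" "T \<noteq> {}" "finite T" by (auto intro: finite_subset)
    have cT: "card T \<le> n" "card T > 0"
      using card_mono[OF _ T(1)] T by (auto simp: card_gt_0_iff)
    define m where "m = n - card T"
    \<comment> \<open>The factors 2 have been taken out; what is left depends on \<sigma> only
      through its values on \<open>T\<close>.\<close>
    define F where "F \<sigma> = (\<Prod>i\<in>T. if e i (\<sigma> i) = 1 then 0 else - 1 :: int)" for \<sigma>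
    have "t T = (\<Sum>\<sigma> | \<sigma> permutes {..<n}. 2 ^ card T * F \<sigma>)"
      unfolding t_def
    proof (rule sum.cong[OF refl])
      fix \<sigma> :: "nat \<Rightarrow> nat"
      have "(\<Prod>i\<in>T. b i (\<sigma> i)) = (\<Prod>i\<in>T. 2 * (if e i (\<sigma> i) = 1 then 0 else - 1))"
        by (rule prod.cong[OF refl]) (simp add: b_def)
      also have "\<dots> = 2 ^ card T * F \<sigma>"
        unfolding F_def prod.distrib by simp
      finally show "(\<Prod>i\<in>T. b i (\<sigma> i)) = 2 ^ card T * F \<sigma>" .
    qed
    also have "\<dots> = 2 ^ card T * (\<Sum>\<sigma> | \<sigma> permutes {..<n}. F \<sigma>)"
      by (simp add: sum_distrib_left)
    finally have t: "t T = 2 ^ card T * (\<Sum>\<sigma> | \<sigma> permutes {..<n}. F \<sigma>)" .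
    have "int (fact (card {..<n} - card T)) dvd (\<Sum>\<sigma> | \<sigma> permutes {..<n}. F \<sigma>)"
      by (rule sum_permutations_dvd[OF _ T(1)]) (auto simp: F_def intro!: prod.cong)
    then have "int (fact m) dvd (\<Sum>\<sigma> | \<sigma> permutes {..<n}. F \<sigma>)" by (simp add: m_def)
    moreover have "2 ^ Suc m dvd 2 ^ k * int (fact m)"
    proof -
      \<comment> \<open>Strict because \<open>T\<close> is nonempty; this gains the one factor 2
        over the term n!.\<close>
      have "m < 2 ^ k - 1" using cT n by (simp add: m_def)
      then have "int (2 ^ Suc m) dvd int (2 ^ k * fact m)"
        using pow2_dvd_fact by (simp only: int_dvd_int_iff)
      then show ?thesis by simp
    qed
    ultimately have "2 ^ Suc m dvd 2 ^ k * (\<Sum>\<sigma> | \<sigma> permutes {..<n}. F \<sigma>)"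
      by (meson dvd_trans mult_dvd_mono dvd_refl)
    then have "2 ^ card T * 2 ^ Suc m dvd 2 ^ card T * (2 ^ k * (\<Sum>\<sigma> | \<sigma> permutes {..<n}. F \<sigma>))"
      by (rule mult_dvd_mono[OF dvd_refl])
    moreover have eq: "(2::int) ^ card T * 2 ^ Suc m = 2 ^ Suc n"
      using cT by (simp add: m_def flip: power_add)
    ultimately show "2 ^ Suc n dvd 2 ^ k * t T"
      unfolding t eq by (simp only: mult.left_commute)
  qed
  ultimately have "2 ^ Suc n dvd 2 ^ k * int (fact n)"
    by simp
  then have "int (2 ^ Suc n) dvd int (2 ^ k * fact n)" by simp
  then have "2 ^ Suc n dvd 2 ^ k * (fact n :: nat)" by (simp only: int_dvd_int_iff)
  moreover obtain c where "odd c" "2 ^ k * (fact n :: nat) = 2 ^ n * c"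
    using fact_mersenne[of k] n by blast
  ultimately show False by simp
qed

section \<open>Orthogonal complements\<close>

interpretation qv: vector_space qscale
  by unfold_locales (auto simp: qscale_def fun_eq_iff algebra_simps)

lemma finite_bitstrs [simp]: "finite (bitstrs n)"
proof (rule finite_subset)
  show "bitstrs n \<subseteq> (\<lambda>X j. j \<in> X) ` Pow {..<n}"
  proof
    fix x assume "x \<in> bitstrs n"
    then have "x = (\<lambda>j. j \<in> {j. x j})" "{j. x j} \<in> Pow {..<n}"
      by (auto simp: bitstrs_def not_le[symmetric])
    then show "x \<in> (\<lambda>X j. j \<in> X) ` Pow {..<n}" by blast
  qed
qed simp

lemma qspace_zero: "v \<in> qspace n \<Longrightarrow> x \<notin> bitstrs n \<Longrightarrow> v x = 0"
  by (simp add: qspace_def)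

lemma subspace_qspace: "qv.subspace (qspace n)"
  unfolding qv.subspace_def by (auto simp: qspace_def qscale_def)

lemma prodvec_conj_in_qspace: "prodvec_conj n S \<psi> \<in> qspace n"
  by (auto simp: prodvec_conj_def qspace_def)

lemma qinner_add_right: "qinner n u (v + w) = qinner n u v + qinner n u w"
  by (simp add: qinner_def distrib_left sum.distrib)

lemma qinner_diff_right: "qinner n u (v - w) = qinner n u v - qinner n u w"
  by (simp add: qinner_def right_diff_distrib sum_subtractf)

lemma qinner_scale_right: "qinner n u (qscale c v) = c * qinner n u v"
  by (simp add: qinner_def qscale_def sum_distrib_left mult.left_commute)

lemma qinner_zero_right: "qinner n u 0 = 0"
  by (simp add: qinner_def)

lemma qinner_cnj: "qinner n v u = cnj (qinner n u v)"
  by (simp add: qinner_def mult.commute)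

lemma qinner_self_eq_0:
  assumes "u \<in> qspace n" "qinner n u u = 0"
  shows "u = 0"
proof
  fix x
  have "qinner n u u = of_real (\<Sum>x\<in>bitstrs n. (cmod (u x))\<^sup>2)"
    by (simp add: qinner_def complex_norm_square mult.commute del: of_real_power)
  then have "(\<Sum>x\<in>bitstrs n. (cmod (u x))\<^sup>2) = 0"
    using assms(2) by (metis of_real_eq_0_iff)
  then have "\<forall>x\<in>bitstrs n. (cmod (u x))\<^sup>2 = 0"
    by (subst (asm) sum_nonneg_eq_0_iff) auto
  then show "u x = 0 x"
    using qspace_zero[OF assms(1)] by (cases "x \<in> bitstrs n") auto
qed

text \<open>The form is conjugate-linear on the left, but its kernel is still a complex subspace;
  orthogonality therefore passes from a set to its span.\<close>

lemma subspace_qinner_left: "qv.subspace {e. qinner n e x = 0}"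
  unfolding qv.subspace_def
  by (auto simp: qinner_cnj[of n _ x] qinner_add_right qinner_scale_right qinner_zero_right)

lemma qinner_span_left:
  "e \<in> qv.span B \<Longrightarrow> \<forall>b\<in>B. qinner n b x = 0 \<Longrightarrow> qinner n e x = 0"
  using qv.span_minimal[OF _ subspace_qinner_left, of B n x] by auto

text \<open>Gram-Schmidt: the new vector \<open>b\<close> is replaced by its part \<open>e\<close>
  orthogonal to the old span, and the projection of \<open>x\<close> is corrected by a multiple of
  \<open>e\<close>.\<close>

lemma orthogonal_projection:
  assumes "finite B" "B \<subseteq> qspace n" "x \<in> qspace n"
  shows "\<exists>d\<in>qv.span B. \<forall>b\<in>B. qinner n b (x - d) = 0"
  using assms
proof (induction B arbitrary: x rule: finite_induct)
  case empty
  show ?case using qv.span_zero by blast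
next
  case (insert b B)
  have B: "qv.span B \<subseteq> qspace n"
    using insert.prems by (intro qv.span_minimal subspace_qspace) auto
  obtain d0 where d0: "d0 \<in> qv.span B" "\<forall>c\<in>B. qinner n c (b - d0) = 0"
    using insert.IH[of b] insert.prems by blast
  obtain d1 where d1: "d1 \<in> qv.span B" "\<forall>c\<in>B. qinner n c (x - d1) = 0"
    using insert.IH[of x] insert.prems by blast
  define e where "e = b - d0"
  have e: "e \<in> qspace n"
    unfolding e_def using insert.prems d0 B by (intro qv.subspace_diff[OF subspace_qspace]) auto
  have mono: "qv.span B \<subseteq> qv.span (insert b B)" by (intro qv.span_mono) auto
  have b: "b = d0 + e" by (simp add: e_def)
  have qb: "qinner n b y = qinner n d0 y + qinner n e y" for y
    unfolding b by (simp add: qinner_cnj[of n _ y] qinner_add_right)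
  \<comment> \<open>If \<open>b\<close> already lies in the old span, then \<open>e = 0\<close>, the
    quotient is 0 by convention and nothing is corrected.\<close>
  define a where "a = qinner n e (x - d1) / qinner n e e"
  define d where "d = d1 + qscale a e"
  have "e \<in> qv.span (insert b B)"
    unfolding e_def by (rule qv.span_diff[OF qv.span_base]) (use d0 mono in auto)
  then have d: "d \<in> qv.span (insert b B)"
    unfolding d_def by (rule qv.span_add[OF subsetD[OF mono d1(1)] qv.span_scale])
  have xd: "qinner n y (x - d) = qinner n y (x - d1) - a * qinner n y e" for y
  proof -
    have "x - d = (x - d1) - qscale a e" by (simp add: d_def)
    then show ?thesis by (simp only: qinner_diff_right qinner_scale_right)
  qed
  have oB: "\<forall>c\<in>B. qinner n c (x - d) = 0"
    using d0(2) d1(2) by (simp add: xd flip: e_def)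
  have "qinner n e (x - d) = 0"
  proof (cases "qinner n e e = 0")
    case True
    then have "e = 0" using qinner_self_eq_0[OF e] by blast
    then show ?thesis by (simp add: qinner_def)
  next
    case False
    then show ?thesis by (simp add: xd a_def)
  qed
  moreover have "qinner n d0 (x - d) = 0"
    using qinner_span_left[OF d0(1) oB] .
  ultimately have "qinner n b (x - d) = 0" by (simp add: qb)
  then show ?case using oB d by blast
qed

text \<open>An infinite basis would have cardinality 0 and make the dimension meaningless as a
  count. Point masses span \<open>qspace n\<close>, so independent subsets are finite.\<close>

lemma finite_basis:
  assumes "V \<subseteq> qspace n"
  shows "\<exists>B. finite B \<and> B \<subseteq> V \<and> V \<subseteq> qv.span B \<and> card B = cdim V"
proof -
  define \<Delta> where "\<Delta> = (\<lambda>y x. if x = y then 1 else 0 :: complex) ` bitstrs n"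
  have span: "qspace n \<subseteq> qv.span \<Delta>"
  proof
    fix v assume v: "v \<in> qspace n"
    have app: "(\<Sum>y\<in>Y. g y) x = (\<Sum>y\<in>Y. g y x)" for Y and g :: "(nat \<Rightarrow> bool) \<Rightarrow> qvec" and x
      by (induction Y rule: infinite_finite_induct) auto
    have "v = (\<Sum>y\<in>bitstrs n. qscale (v y) (\<lambda>x. if x = y then 1 else 0))"
    proof
      fix x
      show "v x = (\<Sum>y\<in>bitstrs n. qscale (v y) (\<lambda>x. if x = y then 1 else 0)) x"
        unfolding app qscale_def using qspace_zero[OF v, of x]
        by (simp add: if_distrib[of "\<lambda>t. _ * t"] sum.delta cong: if_cong)
    qed
    also have "\<dots> \<in> qv.span \<Delta>"
      by (intro qv.span_sum qv.span_scale qv.span_base) (auto simp: \<Delta>_def)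
    finally show "v \<in> qv.span \<Delta>" .
  qed
  obtain B where B: "B \<subseteq> V" "qv.independent B" "V \<subseteq> qv.span B" "card B = qv.dim V"
    using qv.basis_exists by blast
  have "finite B"
    using qv.independent_span_bound[of \<Delta> B] B assms span by (auto simp: \<Delta>_def)
  then show ?thesis using B by (auto simp: cdim_def)
qed

text \<open>The residue of \<open>x\<close> after projection to \<open>D\<close> is orthogonal to
  \<open>D\<close> and to \<open>x\<close>, hence to itself.\<close>

lemma in_double_orth_comp:
  assumes D: "is_qsubspace n D" and x: "x \<in> qspace n"
    and orth: "\<And>e. e \<in> orth_comp n D \<Longrightarrow> qinner n e x = 0"
  shows "x \<in> D"
proof -
  have sub: "qv.subspace D" "D \<subseteq> qspace n"
    using D by (auto simp: is_qsubspace_def qv.subspace_def)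
  obtain B where B: "finite B" "B \<subseteq> D" "D \<subseteq> qv.span B"
    using finite_basis[OF sub(2)] by blast
  obtain d where d: "d \<in> qv.span B" "\<forall>b\<in>B. qinner n b (x - d) = 0"
    using orthogonal_projection[OF B(1) _ x] B(2) sub(2) by blast
  have dD: "d \<in> D" using d(1) qv.span_minimal[OF B(2) sub(1)] by blast
  define e where "e = x - d"
  have e: "e \<in> qspace n"
    unfolding e_def using x dD sub by (intro qv.subspace_diff[OF subspace_qspace]) auto
  have eD: "qinner n e y = 0" if "y \<in> D" for y
    using qinner_span_left[of y B n e] B that d(2) qinner_cnj[of n e y] unfolding e_def by auto
  have "e \<in> orth_comp n D" using e eD by (simp add: orth_comp_def)
  then have "qinner n e x = 0" by (rule orth)
  then have "qinner n e e = 0" using eD[OF dD] by (simp add: e_def qinner_diff_right)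
  then have "e = 0" using e by (rule qinner_self_eq_0[rotated])
  then show ?thesis using dD by (simp add: e_def)
qed

text \<open>Turns membership in \<open>D\<close> into as many scalar equations as the orthogonal
  complement has dimensions.\<close>

lemma orth_comp_equations:
  assumes "is_qsubspace n D"
  shows "\<exists>B. finite B \<and> card B = cdim (orth_comp n D) \<and>
    (\<forall>x\<in>qspace n. (\<forall>b\<in>B. qinner n b x = 0) \<longrightarrow> x \<in> D)"
proof -
  have "orth_comp n D \<subseteq> qspace n" by (auto simp: orth_comp_def)
  then obtain B where B: "finite B" "orth_comp n D \<subseteq> qv.span B" "card B = cdim (orth_comp n D)"
    using finite_basis by blast
  have "x \<in> D" if "x \<in> qspace n" "\<forall>b\<in>B. qinner n b x = 0" for x
    using in_double_orth_comp[OF assms that(1)] qinner_span_left[OF _ that(2)] B(2) by blast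
  then show ?thesis using B by blast
qed

section \<open>Product vectors\<close>

definition Cc :: "nat \<Rightarrow> (('i \<Rightarrow> real) \<Rightarrow> complex) \<Rightarrow> bool" where
  "Cc k f \<longleftrightarrow> Cs k (\<lambda>v. Re (f v)) \<and> Cs k (\<lambda>v. Im (f v))"

lemma Cc_const: "Cc k (\<lambda>v. c)"
  by (simp add: Cc_def)

lemma Cc_of_real: "Cs k f \<Longrightarrow> Cc k (\<lambda>v. complex_of_real (f v))"
  by (simp add: Cc_def)

lemma Cc_cnj: "Cc k f \<Longrightarrow> Cc k (\<lambda>v. cnj (f v))"
  by (simp add: Cc_def Cs_minus)

lemma Cc_add: "Cc k f \<Longrightarrow> Cc k g \<Longrightarrow> Cc k (\<lambda>v. f v + g v)"
  by (simp add: Cc_def Cs_add)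

lemma Cc_mult: "Cc k f \<Longrightarrow> Cc k g \<Longrightarrow> Cc k (\<lambda>v. f v * g v)"
  by (simp add: Cc_def Cs_add Cs_diff Cs_mult)

lemma Cc_sum: "(\<And>i. i \<in> I \<Longrightarrow> Cc k (f i)) \<Longrightarrow> Cc k (\<lambda>v. \<Sum>i\<in>I. f i v)"
  by (induction I rule: infinite_finite_induct) (auto intro: Cc_add Cc_const)

lemma Cc_prod: "(\<And>i. i \<in> I \<Longrightarrow> Cc k (f i)) \<Longrightarrow> Cc k (\<lambda>v. \<Prod>i\<in>I. f i v)"
  by (induction I rule: infinite_finite_induct) (auto intro: Cc_mult Cc_const)

text \<open>A degree one parametrisation of \<open>(P\<^sup>1)\<^sup>n\<close> by \<open>([0,1]\<^sup>2)\<^sup>n\<close>: the coordinate \<open>(j, True)\<close> is the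
  longitude and \<open>(j, False)\<close> the latitude of the \<open>j\<close>-th Bloch sphere.\<close>

definition bloch :: "(nat \<times> bool \<Rightarrow> real) \<Rightarrow> nat \<Rightarrow> bool \<Rightarrow> complex" where
  "bloch v j \<beta> = (if \<beta> then cis (2 * pi * v (j, True)) * of_real (sin (pi / 2 * v (j, False)))
     else of_real (cos (pi / 2 * v (j, False))))"

lemma Cc_bloch: "Cc k (\<lambda>v. bloch v j \<beta>)"
proof (cases \<beta>)
  case True
  have "Cc k (\<lambda>v. cis (2 * pi * v (j, True)))"
    unfolding Cc_def by (auto intro!: Cs_compose[OF C1_cos] Cs_compose[OF C1_sin] Cs_mult Cs_coord)
  moreover have "Cc k (\<lambda>v. complex_of_real (sin (pi / 2 * v (j, False))))"
    by (intro Cc_of_real Cs_compose[OF C1_sin] Cs_mult Cs_coord Cs_const)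
  ultimately show ?thesis using True by (simp add: bloch_def Cc_mult)
next
  case False
  then show ?thesis
    by (simp only: bloch_def if_False) (intro Cc_of_real Cs_compose[OF C1_cos] Cs_mult Cs_coord Cs_const)
qed

lemma prodvec_bloch_nonzero: "prodvec_conj n {} (bloch v) \<noteq> 0"
proof
  assume "prodvec_conj n {} (bloch v) = 0"
  \<comment> \<open>Picks a nonzero coordinate of each factor; sine and cosine of one angle do not
    vanish together.\<close>
  define x where "x j \<longleftrightarrow> j < n \<and> bloch v j False = 0" for j
  have x: "x \<in> bitstrs n" by (simp add: x_def bitstrs_def)
  have "bloch v j (x j) \<noteq> 0" if "j < n" for j
  proof (cases "bloch v j False = 0")
    case True
    then have "sin (pi / 2 * v (j, False)) \<noteq> 0"
      using sin_cos_squared_add[of "pi / 2 * v (j, False)"] by (auto simp: bloch_def)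
    then show ?thesis using True that by (simp add: x_def bloch_def del: sin_zero_iff)
  qed (simp add: x_def)
  then have "prodvec_conj n {} (bloch v) x \<noteq> 0"
    using x by (simp add: prodvec_conj_def)
  then show False using \<open>prodvec_conj n {} (bloch v) = 0\<close> by simp
qed

text \<open>Each equation is linear or conjugate-linear in every factor, so it is a section of
  degree 1 or -1 over each sphere. One turn of the longitude gives \<open>e\<close> the value 2 pi
  times that sign.\<close>

lemma product_vector_common_zero:
  fixes q :: "nat \<Rightarrow> qvec" and S :: "nat \<Rightarrow> nat set"
  assumes n: "n = 2 ^ k - 1"
  shows "\<exists>v. \<forall>i<n. qinner n (q i) (prodvec_conj n (S i) (bloch v)) = 0"
proof -
  define \<phi> where "\<phi> i j \<beta> v = (if j \<in> S i then cnj (bloch v j \<beta>) else bloch v j \<beta>)" for i j \<beta> v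
  define \<epsilon> :: "nat \<Rightarrow> nat \<Rightarrow> int" where "\<epsilon> i j = (if j \<in> S i then - 1 else 1)" for i j
  define e where "e i j = 2 * pi * of_int (\<epsilon> i j)" for i j
  define f where "f i v = qinner n (q i) (prodvec_conj n (S i) (bloch v))" for i v
  have f: "f i = (\<lambda>v. \<Sum>x\<in>bitstrs n. cnj (q i x) * (\<Prod>j<n. \<phi> i j (x j) v))" for i
    by (auto simp: f_def qinner_def prodvec_conj_def \<phi>_def fun_eq_iff intro!: sum.cong prod.cong)
  have Cphi: "Cc (Suc 2) (\<phi> i j \<beta>)" for i j \<beta>
    by (cases "j \<in> S i") (auto simp: \<phi>_def[abs_def] intro: Cc_cnj Cc_bloch)
  have Cf: "Cc (Suc 2) (f i)" for i
    unfolding f by (intro Cc_sum Cc_mult Cc_const Cc_prod Cphi)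
  have phi_other: "\<phi> i l \<beta> (v((j, b) := x)) = \<phi> i l \<beta> v" if "l \<noteq> j" for i l \<beta> v j b x
    using that by (simp add: \<phi>_def bloch_def)
  have scale: "f i v' = c * f i v"
    if j: "j < n" and v': "\<And>l \<beta>. l \<noteq> j \<Longrightarrow> \<phi> i l \<beta> v' = \<phi> i l \<beta> v" "\<And>\<beta>. \<phi> i j \<beta> v' = c * \<phi> i j \<beta> v"
    for i j v v' c
  proof -
    have "(\<Prod>l<n. \<phi> i l (x l) v') = c * (\<Prod>l<n. \<phi> i l (x l) v)" for x
    proof -
      have "(\<Prod>l\<in>{..<n} - {j}. \<phi> i l (x l) v') = (\<Prod>l\<in>{..<n} - {j}. \<phi> i l (x l) v)"
        by (rule prod.cong[OF refl]) (simp add: v'(1))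
      then show ?thesis
        using j by (simp add: prod.remove[of "{..<n}" j] v'(2))
    qed
    then show ?thesis by (simp add: f sum_distrib_left mult.left_commute)
  qed
  have per: "f i (v((j, True) := 1)) = f i (v((j, True) := 0))" if "j < n" for i j v
  proof -
    have "f i (v((j, True) := 1)) = 1 * f i (v((j, True) := 0))"
      by (rule scale[OF that]) (simp_all add: phi_other, simp add: \<phi>_def bloch_def)
    then show ?thesis by simp
  qed
  \<comment> \<open>At latitude 0 the factor is (1, 0); at latitude 1 it is (0, cis (2 pi x)).
    Changing the longitude thus multiplies it by a phase, conjugated when
    \<open>j \<in> S i\<close>.\<close>
  have face: "f i (v((j, False) := \<tau>, (j, True) := x)) =
      cis (e i j * \<tau> * x) * f i (v((j, False) := \<tau>, (j, True) := 0))"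
    if "j < n" "\<tau> \<in> {0, 1}" for i j v x \<tau>
  proof (rule scale[OF that(1)])
    show "\<phi> i j \<beta> (v((j, False) := \<tau>, (j, True) := x)) =
        cis (e i j * \<tau> * x) * \<phi> i j \<beta> (v((j, False) := \<tau>, (j, True) := 0))" for \<beta>
      using that(2) by (cases \<beta>) (auto simp: \<phi>_def bloch_def e_def \<epsilon>_def cis_cnj)
  qed (simp add: phi_other)
  have "\<exists>v. \<forall>i<n. Re (f i v) = 0 \<and> Im (f i v) = 0"
  proof (rule common_zero[where e = e])
    show "Cs (Suc 2) (\<lambda>v. Re (f i v))" "Cs (Suc 2) (\<lambda>v. Im (f i v))" for i
      using Cf unfolding Cc_def by blast+
    have "(\<Sum>\<sigma> | \<sigma> permutes {..<n}. \<Prod>i<n. e i (\<sigma> i)) =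
        (2 * pi) ^ n * of_int (\<Sum>\<sigma> | \<sigma> permutes {..<n}. \<Prod>i<n. \<epsilon> i (\<sigma> i))"
      unfolding e_def prod.distrib by (simp add: sum_distrib_left)
    moreover have "(\<Sum>\<sigma> | \<sigma> permutes {..<n}. \<Prod>i<n. \<epsilon> i (\<sigma> i)) \<noteq> 0"
      by (rule permanent_sign_matrix_nonzero[OF n]) (simp add: \<epsilon>_def)
    ultimately show "(\<Sum>\<sigma> | \<sigma> permutes {..<n}. \<Prod>i<n. e i (\<sigma> i)) \<noteq> 0"
      by (simp del: of_int_sum of_int_prod)
  next
    fix i j v x and \<tau> :: real assume j: "j < n" "\<tau> \<in> {0, 1}"
    show "Re (f i (v((j, False) := \<tau>, (j, True) := x))) =
        cos (e i j * \<tau> * x) * Re (f i (v((j, False) := \<tau>, (j, True) := 0))) -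
        sin (e i j * \<tau> * x) * Im (f i (v((j, False) := \<tau>, (j, True) := 0)))"
      by (subst face[OF j]) (simp del: fun_upd_apply)
    show "Im (f i (v((j, False) := \<tau>, (j, True) := x))) =
        sin (e i j * \<tau> * x) * Re (f i (v((j, False) := \<tau>, (j, True) := 0))) +
        cos (e i j * \<tau> * x) * Im (f i (v((j, False) := \<tau>, (j, True) := 0)))"
      by (subst face[OF j]) (simp del: fun_upd_apply)
  qed (simp_all only: per)
  then show ?thesis by (auto simp: f_def complex_eq_iff)
qed

theorem theorem3p2:
  fixes k n r :: nat and S :: "nat \<Rightarrow> nat set" and D :: "nat \<Rightarrow> qvec set"
  assumes "k \<ge> 2"
    and "n = 2 ^ k - 1"
    and "\<forall>i<r. S i \<subseteq> {0..<n}"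
    and "\<forall>i<r. is_qsubspace n (D i)"
    and "(\<Sum>i<r. cdim (orth_comp n (D i))) \<le> n"
  shows "\<exists>\<psi> :: nat \<Rightarrow> bool \<Rightarrow> complex. prodvec_conj n {} \<psi> \<noteq> 0 \<and>
           (\<forall>i<r. prodvec_conj n (S i) \<psi> \<in> D i)"
proof -
  have "\<forall>i. \<exists>B. i < r \<longrightarrow> finite B \<and> card B = cdim (orth_comp n (D i)) \<and>
      (\<forall>x\<in>qspace n. (\<forall>b\<in>B. qinner n b x = 0) \<longrightarrow> x \<in> D i)"
    using orth_comp_equations assms(4) by blast
  then obtain B where B: "\<And>i. i < r \<Longrightarrow> finite (B i)" "\<And>i. i < r \<Longrightarrow> card (B i) = cdim (orth_comp n (D i))"
    "\<And>i x. i < r \<Longrightarrow> x \<in> qspace n \<Longrightarrow> (\<And>b. b \<in> B i \<Longrightarrow> qinner n b x = 0) \<Longrightarrow> x \<in> D i"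
    by metis
  \<comment> \<open>Tagging each equation with its index \<open>i\<close> keeps apart equal vectors
    that belong to different conjugation patterns.\<close>
  define P where "P = Sigma {..<r} B"
  have finP: "finite P" using B(1) by (auto simp: P_def)
  have "card P = (\<Sum>i<r. cdim (orth_comp n (D i)))"
    unfolding P_def using B(1,2) by (subst card_SigmaI) auto
  then obtain ps where ps: "set ps = P" "length ps \<le> n"
    using finite_distinct_list[OF finP] assms(5) distinct_card by metis
  \<comment> \<open>Pads with trivial equations up to \<open>n\<close>. The set
    \<open>S (fst (ps ! l))\<close> is unspecified for those rows, which is harmless: any sign
    pattern is allowed in a row.\<close>
  define q where "q l = (if l < length ps then snd (ps ! l) else 0)" for l
  obtain v where v: "\<And>l. l < n \<Longrightarrow> qinner n (q l) (prodvec_conj n (S (fst (ps ! l))) (bloch v)) = 0"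
    using product_vector_common_zero[OF assms(2), of q "\<lambda>l. S (fst (ps ! l))"] by blast
  have "prodvec_conj n (S i) (bloch v) \<in> D i" if i: "i < r" for i
  proof (rule B(3)[OF i prodvec_conj_in_qspace])
    fix b assume "b \<in> B i"
    then have "(i, b) \<in> set ps" using i ps by (simp add: P_def)
    then obtain l where l: "l < length ps" "ps ! l = (i, b)" by (auto simp: in_set_conv_nth)
    then show "qinner n b (prodvec_conj n (S i) (bloch v)) = 0"
      using v[of l] ps(2) by (simp add: q_def)
  qed
  then show ?thesis using prodvec_bloch_nonzero by blast
qed

end
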